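(* Let $q = q_1 + i q_2 \in \mathbb{Z}[i]$ with $|q|\geq 2$, let $\gamma\in\mathbb{R}$ satisfy $\gamma^2 + 1/|q|^2 = 1$, and let $$\Lambda = \begin{pmatrix} 1 & \frac{1}{q} \\ 0 & \gamma \end{pmatrix} \mathbb{Z}[i]^2 \subseteq \mathbb{C}^2 .$$ Then $\Lambda$ fails to be a sampling set for the Bargmann-Fock space $\mathcal{F}^2_2$.
   Context: $\mathbb{Z}[i]=\mathbb{Z}+i\mathbb{Z}$ denotes the Gaussian integers. The Bargmann-Fock space $\mathcal{F}^2_2$ consists of all entire functions $F$ of two complex variables $z=(z_1,z_2)\in\mathbb{C}^2$ with $\|F\|_{\mathcal{F}^2_2}^2=\int_{\mathbb{C}^2}|F(z)|^2 e^{-\pi|z|^2}\,dz<\infty$, where $dz$ is Lebesgue measure on $\mathbb{C}^2\cong\mathbb{R}^4$ and $|z|^2=|z_1|^2+|z_2|^2$. A set $\Lambda\subseteq\mathbb{C}^2$ is a sampling set for $\mathcal{F}^2_2$ if there are constants $A,B>0$ such that $A\|F\|_{\mathcal{F}^2_2}^2\leq\sum_{\lambda\in\Lambda}|F(\lambda)|^2e^{-\pi|\lambda|^2}\leq B\|F\|_{\mathcal{F}^2_2}^2$ for all $F\in\mathcal{F}^2_2$. *)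

theory Defs
  imports "HOL-Analysis.Analysis"
begin

definition gaussian_ints :: "complex set" where
  "gaussian_ints = {of_int a + \<i> * of_int b | a b :: int. True}"

(* Holomorphic in several variables: real Frechet differentiable everywhere,
   with complex linear derivative. *)
definition entire :: "(complex ^ 'n \<Rightarrow> complex) \<Rightarrow> bool" where
  "entire F \<longleftrightarrow>
     (\<forall>z. \<exists>D. (F has_derivative D) (at z) \<and> (\<forall>c h. D (c *s h) = c * D h))"

(* The norm on complex ^ 'n is the Hermitian norm, and lborel on it is Lebesgue measure
   on the underlying real space of dimension 2 * CARD('n). *)
definition fock_space :: "(complex ^ 'n \<Rightarrow> complex) set" where
  "fock_space =
     {F. entire F \<and> integrable lborel (\<lambda>z. (cmod (F z))\<^sup>2 * exp (- pi * (norm z)\<^sup>2))}"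

definition fock_norm :: "(complex ^ 'n \<Rightarrow> complex) \<Rightarrow> real" where
  "fock_norm F = sqrt (LINT z|lborel. (cmod (F z))\<^sup>2 * exp (- pi * (norm z)\<^sup>2))"

(* Summability is required explicitly because a divergent real infsum equals 0. *)
definition sampling_set :: "(complex ^ 'n) set \<Rightarrow> bool" where
  "sampling_set \<Lambda> \<longleftrightarrow>
     (\<exists>A>0. \<exists>B>0. \<forall>F\<in>fock_space.
        (\<lambda>l. (cmod (F l))\<^sup>2 * exp (- pi * (norm l)\<^sup>2)) summable_on \<Lambda> \<and>
        A * (fock_norm F)\<^sup>2 \<le> (\<Sum>\<^sub>\<infinity>l\<in>\<Lambda>. (cmod (F l))\<^sup>2 * exp (- pi * (norm l)\<^sup>2)) \<and>
        (\<Sum>\<^sub>\<infinity>l\<in>\<Lambda>. (cmod (F l))\<^sup>2 * exp (- pi * (norm l)\<^sup>2)) \<le> B * (fock_norm F)\<^sup>2)"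

definition gaussian_lattice :: "complex ^ 'n ^ 'n \<Rightarrow> (complex ^ 'n) set" where
  "gaussian_lattice M = (\<lambda>x. M *v x) ` {x. \<forall>i. x $ i \<in> gaussian_ints}"

end

theory Submission
  imports Defs "HOL-Complex_Analysis.Complex_Analysis" "HOL-Probability.Sinc_Integral"
begin

text \<open>
  The lattice consists of the points \<open>(m + n / q, \<gamma> n)\<close> with Gaussian integers \<open>m, n\<close>. It splits
  according to whether \<open>q\<close> divides \<open>n\<close>. If it does, the first coordinate is a Gaussian integer; if it
  does not, the second coordinate lies in the punctured lattice of all \<open>\<gamma> n\<close> with \<open>n\<close> not divisible
  by \<open>q\<close>. Hence a product \<open>\<sigma>(z\<^sub>1) G(z\<^sub>2)\<close> vanishes on the whole lattice as soon as \<open>\<sigma>\<close> vanishes on the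
  Gaussian integers and \<open>G\<close> on the punctured lattice. The density of the punctured lattice is
  \<open>(\<bar>q\<bar>\<^sup>2 - 1) / (\<bar>q\<bar>\<^sup>2 \<gamma>\<^sup>2) = 1\<close> by the hypothesis on \<open>\<gamma>\<close>, the same as that of the Gaussian
  integers, so both factors exist at the critical growth rate: \<open>\<bar>\<sigma>(z)\<bar>\<^sup>2 exp (- \<pi> \<bar>z\<bar>\<^sup>2)\<close> and the
  corresponding expression for \<open>G\<close> are doubly periodic. Here \<open>\<sigma>\<close> is a theta series
  (\<open>fock_sigma\<close>), and \<open>G\<close> is a product of rescaled translates of \<open>\<sigma>\<close>, one for each of the
  \<open>\<bar>q\<bar>\<^sup>2 - 1\<close> nonzero residues modulo \<open>q\<close> (\<open>punctured_lattice_function\<close>).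

  Critical growth just fails to be square integrable, and this is turned into a sequence of Fock space
  functions as follows. Let \<open>H\<close> be \<open>\<sigma>\<close> or \<open>G\<close> with a zero \<open>a\<close>, and let \<open>b\<close> be a translate of \<open>a\<close> by
  a period. The quotient \<open>(b - a) H(z) / ((z - a) (z - b))\<close> is entire and square integrable, and it
  has kept all zeros of \<open>H\<close> except possibly \<open>a\<close> and \<open>b\<close>. At these two points its weighted size does not depend
  on \<open>b\<close>, but its norm tends to infinity with \<open>\<bar>b - a\<bar>\<close>, because the integral of \<open>1 / \<bar>z\<bar>\<^sup>2\<close> over the
  plane diverges logarithmically (\<open>divided_differences_escape\<close>).

  Take such functions \<open>f\<close> for \<open>\<sigma>\<close> and \<open>g\<close> for \<open>G\<close>. On the lattice, \<open>f(z\<^sub>1) g(z\<^sub>2)\<close> lives on two rows and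
  two columns. If the lattice were a sampling set, its upper inequality for \<open>1 \<cdot> g(z\<^sub>2)\<close> and
  \<open>f(z\<^sub>1) \<cdot> 1\<close> would bound the sum over a row by a multiple of \<open>\<parallel>g\<parallel>\<^sup>2\<close> and that over a column by
  a multiple of \<open>\<parallel>f\<parallel>\<^sup>2\<close>. The lower inequality for \<open>f(z\<^sub>1) g(z\<^sub>2)\<close> would then read
  \<open>A \<parallel>f\<parallel>\<^sup>2 \<parallel>g\<parallel>\<^sup>2 \<le> c\<^sub>1 \<parallel>g\<parallel>\<^sup>2 + c\<^sub>2 \<parallel>f\<parallel>\<^sup>2\<close> with constants independent of \<open>f\<close> and \<open>g\<close>, which is
  impossible once both norms are large.
\<close>

no_notation fps_nth (infixl \<open>$\<close> 75)

section \<open>Gaussian integers and residues modulo a Gaussian integer\<close>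

lemma gaussian_ints_of_int: "of_int a \<in> gaussian_ints"
  unfolding gaussian_ints_def by (rule CollectI, intro exI[of _ a] exI[of _ 0]) simp

lemma gaussian_ints_i: "\<i> \<in> gaussian_ints"
  unfolding gaussian_ints_def by (rule CollectI, intro exI[of _ 0] exI[of _ 1]) simp

lemma gaussian_ints_add:
  assumes "x \<in> gaussian_ints" "y \<in> gaussian_ints"
  shows "x + y \<in> gaussian_ints"
proof -
  obtain a b c d where "x = of_int a + \<i> * of_int b" "y = of_int c + \<i> * of_int d"
    using assms by (auto simp: gaussian_ints_def)
  then have "x + y = of_int (a + c) + \<i> * of_int (b + d)" by (simp add: algebra_simps)
  then show ?thesis unfolding gaussian_ints_def by blast
qed

lemma gaussian_ints_mult:
  assumes "x \<in> gaussian_ints" "y \<in> gaussian_ints"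
  shows "x * y \<in> gaussian_ints"
proof -
  obtain a b c d where "x = of_int a + \<i> * of_int b" "y = of_int c + \<i> * of_int d"
    using assms by (auto simp: gaussian_ints_def)
  then have "x * y = of_int (a * c - b * d) + \<i> * of_int (a * d + b * c)"
    by (simp add: algebra_simps)
  then show ?thesis unfolding gaussian_ints_def by blast
qed

lemma gaussian_ints_uminus:
  assumes "x \<in> gaussian_ints"
  shows "- x \<in> gaussian_ints"
  using gaussian_ints_mult[OF gaussian_ints_of_int[of "- 1"] assms] by simp

lemma gaussian_ints_diff:
  assumes "x \<in> gaussian_ints" "y \<in> gaussian_ints"
  shows "x - y \<in> gaussian_ints"
  using gaussian_ints_add[OF assms(1) gaussian_ints_uminus[OF assms(2)]] by simp

lemma gaussian_ints_norm_lt_1: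
  assumes "x \<in> gaussian_ints" "cmod x < 1"
  shows "x = 0"
proof -
  obtain a b where x: "x = of_int a + \<i> * of_int b"
    using assms by (auto simp: gaussian_ints_def)
  have "\<bar>real_of_int a\<bar> < 1" "\<bar>real_of_int b\<bar> < 1"
    using assms(2) abs_Re_le_cmod[of x] abs_Im_le_cmod[of x] by (auto simp: x)
  then have "a = 0" "b = 0" by linarith+
  then show ?thesis by (simp add: x)
qed

text \<open>
  The lattice \<open>q \<int>[\<i>]\<close> with \<open>q = a + b \<i>\<close> contains a vector with imaginary part \<open>d = gcd a b\<close>, by
  Bezout, and the real number \<open>e = \<bar>q\<bar>\<^sup>2 / d\<close>. Subtracting multiples of these moves every Gaussian
  integer into a rectangle of \<open>e d = \<bar>q\<bar>\<^sup>2\<close> points, in which \<open>0\<close> represents the multiples of \<open>q\<close>.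
  The exact count is what gives the function built from these residues its critical growth.
\<close>

lemma gaussian_nonzero_residues:
  assumes q: "q \<in> gaussian_ints" "q \<noteq> 0"
  obtains R where "finite R" "R \<subseteq> gaussian_ints" "real (card R) + 1 = (cmod q)\<^sup>2"
    "\<And>n. n \<in> gaussian_ints \<Longrightarrow> n / q \<notin> gaussian_ints \<Longrightarrow> \<exists>r\<in>R. (n - r) / q \<in> gaussian_ints"
proof -
  obtain a b where ab: "q = of_int a + \<i> * of_int b"
    using q by (auto simp: gaussian_ints_def)
  define d where "d = gcd a b"
  have d: "d > 0" using q(2) by (auto simp: d_def ab)
  obtain a' b' where a': "a = d * a'" and b': "b = d * b'"
    unfolding d_def by (metis dvdE gcd_dvd1 gcd_dvd2)
  obtain s t where st: "s * a + t * b = d"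
    unfolding d_def using bezout_int by blast
  define e where "e = d * (a' * a' + b' * b')"
  have de: "d * e = a * a + b * b" by (simp add: e_def a' b' algebra_simps)
  have "a * a + b * b > 0"
    using q(2) by (auto simp: ab sum_squares_gt_zero_iff)
  then have e: "e > 0" using de d by (metis zero_less_mult_pos)
  define g where "g = (\<lambda>(x::int, y::int). of_int x + \<i> * of_int y :: complex)"
  have g_inj: "inj g" by (auto simp: g_def inj_def complex_eq_iff)
  define R where "R = g ` ({0..<e} \<times> {0..<d} - {(0, 0)})"
  have fin: "finite R" by (simp add: R_def)
  have sub: "R \<subseteq> gaussian_ints" by (auto simp: R_def g_def gaussian_ints_def)
  have "card R = card ({0..<e} \<times> {0..<d} - {(0, 0)})"
    unfolding R_def by (rule card_image) (use g_inj in \<open>auto intro: inj_on_subset\<close>)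
  also have "\<dots> = nat e * nat d - 1"
    using d e by (subst card_Diff_singleton) auto
  finally have "card R + 1 = nat e * nat d"
    using d e by (simp add: nat_mult_distrib[symmetric])
  then have "real (card R + 1) = real (nat e * nat d)" by simp
  also have "\<dots> = real_of_int (d * e)" using d e by simp
  also have "\<dots> = (cmod q)\<^sup>2" unfolding de cmod_power2 by (simp add: ab power2_eq_square)
  finally have card: "real (card R) + 1 = (cmod q)\<^sup>2" by simp
  have cover: "\<exists>r\<in>R. (n - r) / q \<in> gaussian_ints"
    if n: "n \<in> gaussian_ints" "n / q \<notin> gaussian_ints" for n
  proof -
    obtain x y where xy: "n = of_int x + \<i> * of_int y"
      using n by (auto simp: gaussian_ints_def)
    define k where "k = y div d"
    define x' where "x' = x - k * (t * a - s * b)"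
    define l where "l = x' div e"
    define r where "r = g (x' mod e, y mod d)"
    \<comment> \<open>The quotient \<open>(n - r) / q\<close>: first \<open>k\<close> times the vector from Bezout, then \<open>l\<close> times \<open>\<bar>q\<bar>\<^sup>2 / d\<close>, which is
      \<open>q\<close> times the Gaussian integer \<open>cnj q / d\<close>.\<close>
    define w where "w = of_int k * (of_int t + \<i> * of_int s) + of_int l * (of_int a' - \<i> * of_int b')"
    have w_int: "w \<in> gaussian_ints"
      unfolding w_def
      by (intro gaussian_ints_add gaussian_ints_diff gaussian_ints_mult gaussian_ints_of_int gaussian_ints_i)
    have "x = (k * (t * a - s * b) + l * e) + x' mod e"
      by (simp add: x'_def l_def)
    then have re: "of_int x = (of_int (k * (t * a - s * b) + l * e) + of_int (x' mod e) :: complex)"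
      by (metis of_int_add)
    have "y = k * (s * a + t * b) + y mod d" by (simp add: k_def st)
    then have im: "of_int y = (of_int (k * (s * a + t * b)) + of_int (y mod d) :: complex)"
      by (metis of_int_add)
    have "n - r = of_int (k * (t * a - s * b) + l * e) + \<i> * of_int (k * (s * a + t * b))"
      unfolding xy r_def g_def prod.case re im by (simp only: distrib_left) simp
    also have "\<dots> = w * q"
      by (simp add: w_def ab e_def a' b' algebra_simps)
    finally have nr: "(n - r) / q = w" using q by simp
    have "(x' mod e, y mod d) \<noteq> (0, 0)"
    proof
      assume "(x' mod e, y mod d) = (0, 0)"
      then have "r = 0" by (simp add: r_def g_def)
      then show False using nr w_int n by simp
    qed
    then have "r \<in> R" using d e by (auto simp: R_def r_def)
    then show ?thesis using nr w_int by auto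
  qed
  show ?thesis using that fin sub card cover by blast
qed

text \<open>
  The periods of a function form a group, so it suffices to test two generators.
\<close>

lemma gaussian_ints_periodI:
  fixes \<psi> :: "complex \<Rightarrow> 'a"
  assumes one: "\<And>z. \<psi> (z + \<omega>) = \<psi> z" and i: "\<And>z. \<psi> (z + \<omega> * \<i>) = \<psi> z"
    and u: "u \<in> gaussian_ints"
  shows "\<psi> (z + \<omega> * u) = \<psi> z"
proof -
  have nat_mult: "\<psi> (z + of_nat n * t) = \<psi> z" if "\<And>z. \<psi> (z + t) = \<psi> z" for n t z
  proof (induction n)
    case (Suc n)
    have "\<psi> (z + of_nat (Suc n) * t) = \<psi> ((z + of_nat n * t) + t)"
      by (simp add: algebra_simps)
    then show ?case using that Suc by simp
  qed simp
  have int_mult: "\<psi> (z + of_int k * t) = \<psi> z" if "\<And>z. \<psi> (z + t) = \<psi> z" for k t z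
  proof (cases "k \<ge> 0")
    case True
    then show ?thesis using nat_mult[OF that, of z "nat k"] by simp
  next
    case False
    then show ?thesis
      using nat_mult[OF that, of "z + of_int k * t" "nat (- k)"] by simp
  qed
  obtain a b where "u = of_int a + \<i> * of_int b"
    using u by (auto simp: gaussian_ints_def)
  then have "z + \<omega> * u = (z + of_int a * \<omega>) + of_int b * (\<omega> * \<i>)"
    by (simp add: algebra_simps)
  then show ?thesis using int_mult one i by metis
qed

section \<open>The one-variable Fock space\<close>

text \<open>
  The integrand of the squared Fock norm in one variable. All growth conditions and periodicities are
  phrased through it: an entire function at the critical growth rate can have a doubly periodic
  density, although its modulus grows.
\<close>

definition gauss_density :: "(complex \<Rightarrow> complex) \<Rightarrow> complex \<Rightarrow> real" where
  "gauss_density f z = (cmod (f z))\<^sup>2 * exp (- pi * (cmod z)\<^sup>2)"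

lemma gauss_density_nonneg [simp]: "gauss_density f z \<ge> 0"
  by (simp add: gauss_density_def)

definition fock1 :: "(complex \<Rightarrow> complex) set" where
  "fock1 = {f. f holomorphic_on UNIV \<and> integrable lborel (gauss_density f)}"

definition fock1_sqnorm :: "(complex \<Rightarrow> complex) \<Rightarrow> real" where
  "fock1_sqnorm f = (LINT z|lborel. gauss_density f z)"

lemma fock1_sqnorm_nonneg: "fock1_sqnorm f \<ge> 0"
  unfolding fock1_sqnorm_def by (rule Bochner_Integration.integral_nonneg) simp

section \<open>A sigma function for the square lattice\<close>

text \<open>
  With \<open>s = n + 1/2\<close>, the term is \<open>exp (- \<pi> s\<^sup>2 + 2 \<pi> \<i> s z)\<close>, the summand of a Jacobi theta series,
  with the sign \<open>(-1) ^ n\<close> absorbed (up to the constant \<open>\<i>\<close>) into the shift of \<open>z\<close> by \<open>1/2\<close>, times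
  \<open>exp (\<pi> z\<^sup>2 / 2)\<close>. The last factor makes the growth of the sum the same in all directions.
\<close>

definition theta_term :: "int \<Rightarrow> complex \<Rightarrow> complex" where
  "theta_term n z =
     exp (of_real pi *
       (- (of_int n + 1/2)\<^sup>2 + 2 * \<i> * (of_int n + 1/2) * (z + 1/2) + z\<^sup>2 / 2))"

definition fock_sigma :: "complex \<Rightarrow> complex" where
  "fock_sigma z = (\<Sum>\<^sub>\<infinity>n. theta_term n z)"

lemma geometric_summable_on_int:
  fixes x :: real
  assumes "0 \<le> x" "x < 1"
  shows "(\<lambda>n::int. x ^ nat \<bar>n\<bar>) summable_on UNIV"
proof -
  have geo: "(\<lambda>n::nat. x ^ n) summable_on UNIV"
    using assms by (intro summable_nonneg_imp_summable_on summable_geometric) auto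
  have pos: "(\<lambda>n::int. x ^ nat \<bar>n\<bar>) summable_on (range int)"
    using geo by (subst summable_on_reindex) (auto simp: o_def)
  have "(\<lambda>n::int. x ^ nat \<bar>n\<bar>) summable_on (range (\<lambda>n. - int n))"
    using geo by (subst summable_on_reindex) (auto simp: o_def inj_on_def)
  then have neg: "(\<lambda>n::int. x ^ nat \<bar>n\<bar>) summable_on (range (\<lambda>n. - int n) - range int)"
    by (rule summable_on_subset_banach) auto
  have "range int \<union> (range (\<lambda>n. - int n) - range int) = UNIV"
    by (auto simp: image_iff) (metis int_cases2)
  with summable_on_Un_disjoint[OF pos neg] show ?thesis by auto
qed

text \<open>
  The modulus of a term is a Gaussian in \<open>n + 1/2\<close>, and half of its quadratic exponent absorbs the
  linear term coming from the imaginary part of \<open>z\<close>. A geometric majorant is enough for convergence.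
\<close>

lemma norm_theta_term_le:
  assumes "cmod z \<le> R"
  shows "cmod (theta_term n z) \<le> exp (3 * pi * R\<^sup>2 + pi) * exp (- pi / 4) ^ nat \<bar>n\<bar>"
proof -
  define s where "s = real_of_int n + 1/2"
  have "cmod (theta_term n z) = exp (pi * (- s\<^sup>2 - 2 * s * Im z + Re (z\<^sup>2) / 2))"
    by (simp add: theta_term_def s_def power2_eq_square algebra_simps)
  moreover have "- s\<^sup>2 - 2 * s * Im z + Re (z\<^sup>2) / 2 \<le> 3 * R\<^sup>2 + 1 - \<bar>n\<bar> / 4"
  proof -
    have im: "(Im z)\<^sup>2 \<le> R\<^sup>2" using assms abs_Im_le_cmod[of z] by (intro abs_le_square_iff[THEN iffD1]) auto
    have "(cmod z)\<^sup>2 \<le> R\<^sup>2" using assms by (intro power_mono) auto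
    moreover have "Re (z\<^sup>2) \<le> (cmod z)\<^sup>2"
      using complex_Re_le_cmod[of "z\<^sup>2"] by (simp add: norm_power)
    ultimately have re: "Re (z\<^sup>2) \<le> R\<^sup>2" by linarith
    have "(s + 2 * Im z)\<^sup>2 \<ge> 0" by simp
    then have cross: "- 2 * s * Im z \<le> s\<^sup>2 / 2 + 2 * (Im z)\<^sup>2"
      by (simp add: power2_eq_square algebra_simps)
    have "(\<bar>s\<bar> - 1/4)\<^sup>2 \<ge> 0" by simp
    then have "s\<^sup>2 \<ge> \<bar>s\<bar> / 2 - 1/16"
      by (simp add: power2_diff) (simp add: power2_eq_square)
    moreover have "\<bar>s\<bar> \<ge> \<bar>n\<bar> - 1/2" unfolding s_def by linarith
    ultimately have "- s\<^sup>2 / 2 \<le> 1 - \<bar>n\<bar> / 4" by simp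
    moreover have "0 \<le> R\<^sup>2" by simp
    ultimately show ?thesis using im re cross by linarith
  qed
  ultimately have "cmod (theta_term n z) \<le> exp (pi * (3 * R\<^sup>2 + 1 - \<bar>n\<bar> / 4))"
    by simp
  also have "\<dots> = exp (3 * pi * R\<^sup>2 + pi) * exp (- pi / 4) ^ nat \<bar>n\<bar>"
    by (simp add: exp_of_nat_mult[symmetric] exp_add[symmetric] algebra_simps)
  finally show ?thesis .
qed

lemma theta_majorant_summable:
  "(\<lambda>n::int. exp (3 * pi * R\<^sup>2 + pi) * exp (- pi / 4) ^ nat \<bar>n\<bar>) summable_on UNIV"
  by (intro summable_on_cmult_right geometric_summable_on_int) auto

lemma theta_term_summable: "(\<lambda>n. theta_term n z) summable_on UNIV"
  by (rule abs_summable_summable, rule summable_on_comparison_test[OF theta_majorant_summable[of "cmod z"]])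
     (use norm_theta_term_le[of z "cmod z"] in auto)

lemma fock_sigma_holomorphic: "fock_sigma holomorphic_on UNIV"
proof -
  have "fock_sigma holomorphic_on ball 0 R" for R
  proof (rule holomorphic_uniform_limit)
    show "uniform_limit (cball 0 R) (\<lambda>X z. \<Sum>n\<in>X. theta_term n z) fock_sigma
            (finite_subsets_at_top UNIV)"
      unfolding fock_sigma_def
      by (rule Weierstrass_m_test_general[OF _ theta_majorant_summable[of R]])
         (use norm_theta_term_le in simp)
    have "theta_term n holomorphic_on UNIV" for n
      unfolding theta_term_def by (intro holomorphic_intros) auto
    then have hol: "(\<lambda>z. \<Sum>n\<in>X. theta_term n z) holomorphic_on UNIV" for X
      by (intro holomorphic_on_sum) auto
    show "\<forall>\<^sub>F X in finite_subsets_at_top UNIV.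
        continuous_on (cball 0 R) (\<lambda>z. \<Sum>n\<in>X. theta_term n z) \<and>
        (\<lambda>z. \<Sum>n\<in>X. theta_term n z) holomorphic_on ball 0 R"
      using hol by (intro always_eventually allI)
         (meson holomorphic_on_imp_continuous_on holomorphic_on_subset top_greatest)
  qed auto
  then have "fock_sigma field_differentiable (at z)" for z
    by (metis dist_0_norm holomorphic_on_imp_differentiable_at less_add_one mem_ball open_ball)
  then show ?thesis by (simp add: holomorphic_on_def)
qed

lemma exp_odd_multiple_pi_i: "exp (of_real pi * \<i> * (2 * of_int n + 1)) = (-1 :: complex)"
proof -
  have "exp (of_real pi * \<i> * (2 * of_int n + 1)) =
      exp (2 * of_real pi * \<i> * of_int n) * exp (of_real pi * \<i> :: complex)"
    by (simp add: exp_add[symmetric] algebra_simps)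
  also have "\<dots> = -1"
    using exp_integer_2pi[of "of_int n"] by (simp add: mult_ac)
  finally show ?thesis .
qed

lemma fock_sigma_add_1: "fock_sigma (z + 1) = - exp (of_real pi * (z + 1/2)) * fock_sigma z"
proof -
  have "theta_term n (z + 1) = - exp (of_real pi * (z + 1/2)) * theta_term n z" for n
  proof -
    have "of_real pi * (- (of_int n + 1/2)\<^sup>2 + 2 * \<i> * (of_int n + 1/2) * (z + 1 + 1/2) + (z + 1)\<^sup>2 / 2)
      = of_real pi * \<i> * (2 * of_int n + 1) + of_real pi * (z + 1/2)
        + of_real pi * (- (of_int n + 1/2)\<^sup>2 + 2 * \<i> * (of_int n + 1/2) * (z + 1/2) + z\<^sup>2 / 2)"
      by (simp add: power2_eq_square field_simps)
    then show ?thesis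
      unfolding theta_term_def by (simp only: exp_add exp_odd_multiple_pi_i) simp
  qed
  then show ?thesis
    by (simp add: fock_sigma_def infsum_uminus infsum_cmult_right')
qed

text \<open>
  Completing the square turns the translation by \<open>\<i>\<close> into the index shift \<open>n \<mapsto> n + 1\<close>.
\<close>

lemma fock_sigma_add_i:
  "fock_sigma (z + \<i>) = exp (of_real pi * (1/2 - \<i> - \<i> * z)) * fock_sigma z"
proof -
  have "theta_term n (z + \<i>) = exp (of_real pi * (1/2 - \<i> - \<i> * z)) * theta_term (n + 1) z" for n
  proof -
    have "of_real pi * (- (of_int n + 1/2)\<^sup>2 + 2 * \<i> * (of_int n + 1/2) * (z + \<i> + 1/2) + (z + \<i>)\<^sup>2 / 2)
      = of_real pi * (1/2 - \<i> - \<i> * z)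
        + of_real pi * (- (of_int (n + 1) + 1/2)\<^sup>2 + 2 * \<i> * (of_int (n + 1) + 1/2) * (z + 1/2) + z\<^sup>2 / 2)"
      by (simp add: power2_eq_square field_simps)
    then show ?thesis
      unfolding theta_term_def by (simp only: exp_add)
  qed
  then have "fock_sigma (z + \<i>) =
      exp (of_real pi * (1/2 - \<i> - \<i> * z)) * (\<Sum>\<^sub>\<infinity>n. theta_term (n + 1) z)"
    by (simp add: fock_sigma_def infsum_cmult_right')
  also have "(\<Sum>\<^sub>\<infinity>n. theta_term (n + 1) z) = fock_sigma z"
    unfolding fock_sigma_def
    by (rule infsum_reindex_bij_betw[where g="\<lambda>n::int. n + 1" and f="\<lambda>n. theta_term n z"])
       (rule bij_betwI[where g="\<lambda>n. n - 1"], auto)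
  finally show ?thesis .
qed

text \<open>
  A change of modulus by exactly the factor that the Gaussian weight compensates.
\<close>

lemma gauss_density_quasi_periodic:
  assumes "cmod (f w) = exp (pi * c) * cmod (f z)" and "(cmod w)\<^sup>2 = (cmod z)\<^sup>2 + 2 * c"
  shows "gauss_density f w = gauss_density f z"
proof -
  have "gauss_density f w = (cmod (f z))\<^sup>2 * (exp (pi * c) ^ 2 * exp (- pi * ((cmod z)\<^sup>2 + 2 * c)))"
    by (simp add: gauss_density_def assms power_mult_distrib)
  also have "exp (pi * c) ^ 2 * exp (- pi * ((cmod z)\<^sup>2 + 2 * c)) = exp (- pi * (cmod z)\<^sup>2)"
    by (simp add: exp_double[symmetric] exp_add[symmetric] algebra_simps)
  finally show ?thesis by (simp add: gauss_density_def)
qed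

lemma fock_sigma_density_periodic:
  assumes "u \<in> gaussian_ints"
  shows "gauss_density fock_sigma (z + u) = gauss_density fock_sigma z"
proof -
  have 1: "gauss_density fock_sigma (z + 1) = gauss_density fock_sigma z" for z
  proof (rule gauss_density_quasi_periodic)
    show "cmod (fock_sigma (z + 1)) = exp (pi * (Re z + 1/2)) * cmod (fock_sigma z)"
      by (simp add: fock_sigma_add_1 norm_mult)
    show "(cmod (z + 1))\<^sup>2 = (cmod z)\<^sup>2 + 2 * (Re z + 1/2)"
      unfolding cmod_power2 by (simp add: power2_eq_square algebra_simps)
  qed
  have i: "gauss_density fock_sigma (z + \<i>) = gauss_density fock_sigma z" for z
  proof (rule gauss_density_quasi_periodic)
    show "cmod (fock_sigma (z + \<i>)) = exp (pi * (Im z + 1/2)) * cmod (fock_sigma z)"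
      unfolding fock_sigma_add_i norm_mult by (simp add: add_ac)
    show "(cmod (z + \<i>))\<^sup>2 = (cmod z)\<^sup>2 + 2 * (Im z + 1/2)"
      unfolding cmod_power2 by (simp add: power2_eq_square algebra_simps)
  qed
  show ?thesis
    using gaussian_ints_periodI[where \<psi>="gauss_density fock_sigma" and \<omega>=1, of u z] 1 i assms by simp
qed

text \<open>
  The reflection \<open>n \<mapsto> - 1 - n\<close> changes the sign of every term at the origin.
\<close>

lemma fock_sigma_0: "fock_sigma 0 = 0"
proof -
  have "theta_term (- 1 - n) 0 = - theta_term n 0" for n
  proof -
    have "of_real pi * (- (of_int n + 1/2)\<^sup>2 + 2 * \<i> * (of_int n + 1/2) * (0 + 1/2) + 0\<^sup>2 / 2)
      = of_real pi * \<i> * (2 * of_int n + 1)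
        + of_real pi * (- (of_int (- 1 - n) + 1/2)\<^sup>2 + 2 * \<i> * (of_int (- 1 - n) + 1/2) * (0 + 1/2) + 0\<^sup>2 / 2 :: complex)"
      by (simp add: power2_eq_square field_simps)
    then have "theta_term n 0 = - theta_term (- 1 - n) 0"
      unfolding theta_term_def by (simp only: exp_add exp_odd_multiple_pi_i) simp
    then show ?thesis by simp
  qed
  then have "- fock_sigma 0 = (\<Sum>\<^sub>\<infinity>n. theta_term (- 1 - n) 0)"
    by (simp add: fock_sigma_def infsum_uminus)
  also have "\<dots> = fock_sigma 0"
    unfolding fock_sigma_def
    by (rule infsum_reindex_bij_betw[where g="\<lambda>n::int. - 1 - n" and f="\<lambda>n. theta_term n 0"])
       (rule bij_betwI[where g="\<lambda>n. - 1 - n"], auto)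
  finally show ?thesis by simp
qed

lemma fock_sigma_gaussian_int:
  assumes "u \<in> gaussian_ints"
  shows "fock_sigma u = 0"
  using fock_sigma_density_periodic[OF assms, of 0] by (simp add: gauss_density_def fock_sigma_0)

text \<open>
  At \<open>- 1/2\<close> the terms are positive real numbers.
\<close>

lemma fock_sigma_nonzero: "fock_sigma (- 1/2) \<noteq> 0"
proof
  assume 0: "fock_sigma (- 1/2) = 0"
  have term_real: "theta_term n (- 1/2) = of_real (exp (pi * (- (of_int n + 1/2)\<^sup>2 + 1/8)))" for n
    by (simp add: theta_term_def power2_eq_square exp_of_real[symmetric])
  define t where "t n = exp (pi * (- (real_of_int n + 1/2)\<^sup>2 + 1/8))" for n
  have t_pos: "t n > 0" for n by (simp add: t_def)
  have sum: "t summable_on UNIV"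
    using summable_on_Re[OF theta_term_summable[of "- 1/2"]]
    unfolding term_real by (simp add: t_def[abs_def])
  have "fock_sigma (- 1/2) = of_real (\<Sum>\<^sub>\<infinity>n. t n)"
    unfolding fock_sigma_def term_real t_def[symmetric]
    using has_sum_of_real[OF has_sum_infsum[OF sum]] by (rule infsumI)
  then have "(\<Sum>\<^sub>\<infinity>n. t n) = 0" using 0 by simp
  moreover have "t 0 \<le> (\<Sum>\<^sub>\<infinity>n. t n)"
    using infsum_mono2[of t "{0}" UNIV] sum less_imp_le[OF t_pos] by simp
  ultimately show False using t_pos[of 0] by simp
qed

section \<open>Divided differences of lattice functions escape\<close>

lemma continuous_gauss_density:
  assumes "f holomorphic_on UNIV"
  shows "continuous_on UNIV (gauss_density f)"
  unfolding gauss_density_def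
  by (intro continuous_intros holomorphic_on_imp_continuous_on assms)

text \<open>
  The function is dominated by the product of \<open>1 / (1 + x\<^sup>2)\<close> and \<open>1 / (1 + y\<^sup>2)\<close>.
\<close>

lemma integrable_inverse_square_decay:
  "integrable lborel (\<lambda>z::complex. 1 / (1 + (cmod z)\<^sup>2)\<^sup>2)"
proof -
  have real_int: "integrable lborel (\<lambda>x::real. 1 / (1 + x\<^sup>2))"
    using integrable_inverse_1_plus_square
    by (simp add: set_integrable_def inverse_eq_divide)
  have "(\<integral>\<^sup>+z. (\<Prod>b\<in>Basis. ennreal (1 / (1 + (z \<bullet> b)\<^sup>2))) \<partial>(lborel :: complex measure))
      = (\<Prod>b\<in>(Basis :: complex set). \<integral>\<^sup>+x. ennreal (1 / (1 + x\<^sup>2)) \<partial>lborel)"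
    by (rule nn_integral_lborel_prod) auto
  also have "\<dots> < \<infinity>"
    using real_int by (auto simp: integrable_iff_bounded Basis_complex_def ennreal_mult_less_top)
  finally have fin: "(\<integral>\<^sup>+z. (\<Prod>b\<in>Basis. ennreal (1 / (1 + (z \<bullet> b)\<^sup>2))) \<partial>(lborel :: complex measure)) < \<infinity>" .
  have le: "1 / (1 + (cmod z)\<^sup>2)\<^sup>2 \<le> 1 / (1 + (Re z)\<^sup>2) * (1 / (1 + (Im z)\<^sup>2))" for z
  proof -
    have "(1 + (Re z)\<^sup>2) * (1 + (Im z)\<^sup>2) \<le> (1 + (cmod z)\<^sup>2) * (1 + (cmod z)\<^sup>2)"
      by (intro mult_mono) (auto simp: cmod_power2)
    then show ?thesis
      by (simp add: power2_eq_square[of "1 + _"] frac_le add_pos_nonneg)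
  qed
  have prod: "(\<Prod>b\<in>Basis. ennreal (1 / (1 + (z \<bullet> b)\<^sup>2)))
      = ennreal (1 / (1 + (Re z)\<^sup>2) * (1 / (1 + (Im z)\<^sup>2)))" for z :: complex
    by (simp add: Basis_complex_def ennreal_mult[symmetric])
  show ?thesis
  proof (rule integrableI_bounded)
    have "(\<integral>\<^sup>+z. ennreal (norm (1 / (1 + (cmod z)\<^sup>2)\<^sup>2)) \<partial>lborel)
      \<le> (\<integral>\<^sup>+z. (\<Prod>b\<in>Basis. ennreal (1 / (1 + (z \<bullet> b)\<^sup>2))) \<partial>(lborel :: complex measure))"
      unfolding prod by (intro nn_integral_mono ennreal_leI) (use le in auto)
    also note fin
    finally show "(\<integral>\<^sup>+z. ennreal (norm (1 / (1 + (cmod z)\<^sup>2)\<^sup>2)) \<partial>(lborel :: complex measure)) < \<infinity>" .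
  qed measurable
qed

lemma integrable_lborel_of_decay:
  fixes h :: "complex \<Rightarrow> real"
  assumes cont: "continuous_on UNIV h"
    and decay: "\<And>z. R \<le> cmod z \<Longrightarrow> \<bar>h z\<bar> \<le> C / (1 + (cmod z)\<^sup>2)\<^sup>2"
  shows "integrable lborel h"
proof -
  have "continuous_on (cball 0 \<bar>R\<bar>) h" using cont continuous_on_subset by blast
  then have "bounded (h ` cball 0 \<bar>R\<bar>)"
    by (intro compact_imp_bounded compact_continuous_image) auto
  then obtain K where "K > 0" and K: "\<And>z. cmod z \<le> \<bar>R\<bar> \<Longrightarrow> \<bar>h z\<bar> \<le> K"
    unfolding bounded_pos by (auto simp: image_iff)
  let ?D = "K * (1 + R\<^sup>2)\<^sup>2 + \<bar>C\<bar>"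
  have bound: "\<bar>h z\<bar> \<le> ?D * (1 / (1 + (cmod z)\<^sup>2)\<^sup>2)" for z
  proof (cases "cmod z \<le> \<bar>R\<bar>")
    case True
    then have "(cmod z)\<^sup>2 \<le> R\<^sup>2" by (metis abs_norm_cancel abs_le_square_iff)
    then have "(1 + (cmod z)\<^sup>2)\<^sup>2 \<le> (1 + R\<^sup>2)\<^sup>2" by (intro power_mono) auto
    then have "K * (1 + (cmod z)\<^sup>2)\<^sup>2 \<le> ?D" using \<open>K > 0\<close> by (simp add: add_increasing2)
    moreover have "0 < (1 + (cmod z)\<^sup>2)\<^sup>2" by (intro zero_less_power add_pos_nonneg) auto
    ultimately have "K \<le> ?D * (1 / (1 + (cmod z)\<^sup>2)\<^sup>2)"
      by (simp add: pos_le_divide_eq)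
    then show ?thesis using K[OF True] by linarith
  next
    case False
    then have "\<bar>h z\<bar> \<le> C / (1 + (cmod z)\<^sup>2)\<^sup>2" by (intro decay) auto
    also have "\<dots> \<le> ?D * (1 / (1 + (cmod z)\<^sup>2)\<^sup>2)"
      using \<open>K > 0\<close> by (simp add: divide_right_mono add_increasing)
    finally show ?thesis .
  qed
  show ?thesis
  proof (rule Bochner_Integration.integrable_bound)
    show "integrable lborel (\<lambda>z::complex. ?D * (1 / (1 + (cmod z)\<^sup>2)\<^sup>2))"
      by (intro integrable_mult_right integrable_inverse_square_decay)
    show "h \<in> borel_measurable lborel"
      using cont by (simp add: borel_measurable_continuous_onI)
    show "AE z in lborel. norm (h z) \<le> norm (?D * (1 / (1 + (cmod z)\<^sup>2)\<^sup>2))"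
      using bound by (intro AE_I2) (smt (verit) real_norm_def)
  qed
qed

text \<open>
  Every point can be translated by a period into a fixed compact disc around the origin.
\<close>

lemma periodic_continuous_bounded:
  fixes \<psi> :: "complex \<Rightarrow> real"
  assumes cont: "continuous_on UNIV \<psi>" and "\<omega> \<noteq> 0"
    and per: "\<And>u z. u \<in> gaussian_ints \<Longrightarrow> \<psi> (z + \<omega> * u) = \<psi> z"
  shows "\<exists>M>0. \<forall>z. \<psi> z \<le> M"
proof -
  have "continuous_on (cball 0 (2 * cmod \<omega>)) \<psi>" using cont continuous_on_subset by blast
  then have "bounded (\<psi> ` cball 0 (2 * cmod \<omega>))"
    by (intro compact_imp_bounded compact_continuous_image) auto
  then obtain M where "M > 0" and M: "\<And>z. cmod z \<le> 2 * cmod \<omega> \<Longrightarrow> \<bar>\<psi> z\<bar> \<le> M"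
    unfolding bounded_pos by (auto simp: image_iff)
  have "\<psi> z \<le> M" for z
  proof -
    define u where "u = of_int \<lfloor>Re (z / \<omega>)\<rfloor> + \<i> * of_int \<lfloor>Im (z / \<omega>)\<rfloor>"
    define w where "w = z - \<omega> * u"
    have u: "u \<in> gaussian_ints" by (auto simp: u_def gaussian_ints_def)
    have "w = \<omega> * (z / \<omega> - u)" using \<open>\<omega> \<noteq> 0\<close> by (simp add: w_def field_simps)
    moreover have "cmod (z / \<omega> - u) \<le> \<bar>Re (z / \<omega> - u)\<bar> + \<bar>Im (z / \<omega> - u)\<bar>"
      by (rule cmod_le)
    moreover have "\<bar>Re (z / \<omega> - u)\<bar> \<le> 1" "\<bar>Im (z / \<omega> - u)\<bar> \<le> 1"
      by (simp_all add: u_def) linarith+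
    ultimately have "cmod w \<le> 2 * cmod \<omega>"
      by (simp add: norm_mult mult.commute[of "cmod \<omega>"] mult_right_mono)
    moreover have "\<psi> z = \<psi> w" using per[OF u, of w] by (simp add: w_def)
    ultimately show ?thesis using M[of w] by auto
  qed
  with \<open>M > 0\<close> show ?thesis by blast
qed

definition quotient_at :: "(complex \<Rightarrow> complex) \<Rightarrow> complex \<Rightarrow> complex \<Rightarrow> complex" where
  "quotient_at H c z = (if z = c then deriv H c else H z / (z - c))"

lemma quotient_at_holomorphic:
  assumes "H holomorphic_on UNIV" "H c = 0"
  shows "quotient_at H c holomorphic_on UNIV"
  by (rule pole_theorem_open_0[OF assms(1) open_UNIV])
     (auto simp: quotient_at_def assms)

text \<open>
  At a zero \<open>c\<close> of \<open>H\<close>, the density of the derivative is the limit of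
  \<open>gauss_density H (c + h) / \<bar>h\<bar>\<^sup>2\<close>, and these quotients agree at \<open>a\<close> and \<open>a + t\<close>. Thus no explicit
  multiplier of \<open>H\<close> under the translation is needed.
\<close>

lemma gauss_density_deriv_periodic:
  assumes hol: "H holomorphic_on UNIV" and "H a = 0"
    and per: "\<And>z. gauss_density H (z + t) = gauss_density H z"
  shows "gauss_density (deriv H) (a + t) = gauss_density (deriv H) a"
proof -
  have "gauss_density H (a + t) = 0" using per[of a] \<open>H a = 0\<close> by (simp add: gauss_density_def)
  then have b0: "H (a + t) = 0" by (simp add: gauss_density_def)
  have lim: "((\<lambda>h. gauss_density H (c + h) / (cmod h)\<^sup>2) \<longlongrightarrow> gauss_density (deriv H) c) (at 0)"
    if c: "H c = 0" for c
  proof -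
    have "(H has_field_derivative deriv H c) (at c)"
      using hol by (simp add: holomorphic_derivI)
    then have "((\<lambda>h. H (c + h) / h) \<longlongrightarrow> deriv H c) (at 0)"
      by (simp add: DERIV_def c)
    then have "((\<lambda>h. (cmod (H (c + h) / h))\<^sup>2 * exp (- pi * (cmod (c + h))\<^sup>2))
        \<longlongrightarrow> (cmod (deriv H c))\<^sup>2 * exp (- pi * (cmod (c + 0))\<^sup>2)) (at 0)"
      by (intro tendsto_intros)
    then show ?thesis
      by (simp add: gauss_density_def norm_divide power_divide)
  qed
  have "gauss_density H (a + t + h) = gauss_density H (a + h)" for h
    using per[of "a + h"] by (simp add: add_ac)
  with lim[OF b0] have "((\<lambda>h. gauss_density H (a + h) / (cmod h)\<^sup>2)
      \<longlongrightarrow> gauss_density (deriv H) (a + t)) (at 0)" by simp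
  with lim[OF \<open>H a = 0\<close>] show ?thesis using LIM_unique by blast
qed

lemma norm_diff_sq_ge_of_far:
  assumes "2 * cmod c + 1 \<le> cmod z"
  shows "(1 + (cmod z)\<^sup>2) / 8 \<le> (cmod (z - c))\<^sup>2"
proof -
  have "cmod (z - c) \<ge> cmod z / 2"
    using assms norm_triangle_ineq2[of z c] by linarith
  then have "(cmod z / 2)\<^sup>2 \<le> (cmod (z - c))\<^sup>2" by (intro power_mono) auto
  moreover have "1 \<le> cmod z" using assms norm_ge_zero[of c] by linarith
  then have "(1 + (cmod z)\<^sup>2) / 8 \<le> (cmod z / 2)\<^sup>2"
    using power_mono[of 1 "cmod z" 2] by (simp add: power_divide)
  ultimately show ?thesis by linarith
qed

text \<open>
  As a difference of two quotients by a single linear factor, the function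
  \<open>(b - a) H(z) / ((z - a) (z - b))\<close> is visibly entire and has the right values at \<open>a\<close> and \<open>b\<close>.
\<close>

definition divided_difference :: "(complex \<Rightarrow> complex) \<Rightarrow> complex \<Rightarrow> complex \<Rightarrow> complex \<Rightarrow> complex" where
  "divided_difference H a b z = quotient_at H b z - quotient_at H a z"

lemma divided_difference_holomorphic:
  assumes "H holomorphic_on UNIV" "H a = 0" "H b = 0"
  shows "divided_difference H a b holomorphic_on UNIV"
  unfolding divided_difference_def by (intro holomorphic_intros quotient_at_holomorphic assms)

lemma divided_difference_eq:
  assumes "z \<noteq> a" "z \<noteq> b"
  shows "divided_difference H a b z = H z * (b - a) / ((z - a) * (z - b))"
  using assms by (simp add: divided_difference_def quotient_at_def field_simps)

lemma gauss_density_divided_difference: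
  assumes "z \<noteq> a" "z \<noteq> b"
  shows "gauss_density (divided_difference H a b) z =
    gauss_density H z * (cmod (b - a))\<^sup>2 / ((cmod (z - a))\<^sup>2 * (cmod (z - b))\<^sup>2)"
  using divided_difference_eq[OF assms]
  by (simp add: gauss_density_def norm_mult norm_divide power_mult_distrib power_divide mult_ac)

lemma gauss_density_divided_difference_at_zero:
  assumes "H a = 0" "H b = 0" "a \<noteq> b"
  shows "gauss_density (divided_difference H a b) a = gauss_density (deriv H) a"
    and "gauss_density (divided_difference H a b) b = gauss_density (deriv H) b"
  using assms by (simp_all add: gauss_density_def divided_difference_def quotient_at_def)

text \<open>
  The two linear factors in the denominator give decay of order \<open>\<bar>z\<bar>\<^sup>-\<^sup>4\<close> in the density.
\<close>

lemma integrable_divided_difference: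
  assumes hol: "H holomorphic_on UNIV" and zero: "H a = 0" "H b = 0"
    and M: "M > 0" "\<And>z. gauss_density H z \<le> M"
  shows "integrable lborel (gauss_density (divided_difference H a b))"
proof (rule integrable_lborel_of_decay)
  let ?f = "divided_difference H a b"
  show "continuous_on UNIV (gauss_density ?f)"
    by (intro continuous_gauss_density divided_difference_holomorphic hol zero)
  fix z assume z: "2 * (cmod a + cmod b) + 1 \<le> cmod z"
  have far: "(1 + (cmod z)\<^sup>2) / 8 \<le> (cmod (z - c))\<^sup>2" if "c \<in> {a, b}" for c
    using z that norm_ge_zero[of a] norm_ge_zero[of b]
    by (intro norm_diff_sq_ge_of_far) (smt (verit) insertE singletonD)
  have ne: "z \<noteq> c" if "c \<in> {a, b}" for c
    using far[OF that] zero_le_power2[of "cmod z"] by (smt (verit) divide_pos_pos norm_zero right_minus_eq zero_power2)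
  have "\<bar>gauss_density ?f z\<bar> =
      gauss_density H z * (cmod (b - a))\<^sup>2 / ((cmod (z - a))\<^sup>2 * (cmod (z - b))\<^sup>2)"
    using gauss_density_divided_difference[of z a b H] ne by simp
  also have "\<dots> \<le> M * (cmod (b - a))\<^sup>2 / ((1 + (cmod z)\<^sup>2) / 8 * ((1 + (cmod z)\<^sup>2) / 8))"
  proof (rule frac_le)
    have "0 < 1 + (cmod z)\<^sup>2" by (simp add: add_pos_nonneg)
    then show "0 < (1 + (cmod z)\<^sup>2) / 8 * ((1 + (cmod z)\<^sup>2) / 8)" by simp
    show "(1 + (cmod z)\<^sup>2) / 8 * ((1 + (cmod z)\<^sup>2) / 8) \<le> (cmod (z - a))\<^sup>2 * (cmod (z - b))\<^sup>2"
      using far by (intro mult_mono) auto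
    show "gauss_density H z * (cmod (b - a))\<^sup>2 \<le> M * (cmod (b - a))\<^sup>2"
      using M by (intro mult_right_mono) auto
    show "0 \<le> M * (cmod (b - a))\<^sup>2" using M(1) by simp
  qed
  also have "\<dots> = 64 * M * (cmod (b - a))\<^sup>2 / (1 + (cmod z)\<^sup>2)\<^sup>2"
    by (simp add: power2_eq_square)
  finally show "\<bar>gauss_density ?f z\<bar> \<le> 64 * M * (cmod (b - a))\<^sup>2 / (1 + (cmod z)\<^sup>2)\<^sup>2" .
qed

text \<open>
  The balls around the lattice points \<open>p + \<omega> (j + k \<i>)\<close> are disjoint, and the \<open>j\<close> balls with
  \<open>1 \<le> k \<le> j\<close> together contribute a multiple of \<open>j / j\<^sup>2 = 1 / j\<close>. This is the logarithmic divergence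
  of the integral of \<open>1 / \<bar>z\<bar>\<^sup>2\<close> in discrete form.
\<close>

lemma integral_ge_harmonic_of_lattice_balls:
  fixes h :: "complex \<Rightarrow> real"
  assumes int: "integrable lborel h" and nonneg: "\<And>z. h z \<ge> 0"
    and r: "r > 0" "2 * r \<le> cmod \<omega>"
    and lower: "\<And>j k z. 1 \<le> k \<Longrightarrow> k \<le> j \<Longrightarrow> j \<le> n \<Longrightarrow>
      z \<in> ball (p + \<omega> * (of_nat j + \<i> * of_nat k)) r \<Longrightarrow> c / (real j)\<^sup>2 \<le> h z"
  shows "c * measure lborel (ball (0::complex) r) * harm n \<le> (LINT z|lborel. h z)"
proof -
  define V where "V = measure lborel (ball (0::complex) r)"
  define cen where "cen j k = p + \<omega> * (of_nat j + \<i> * of_nat k)" for j k :: nat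
  define I where "I = (SIGMA j:{1..n}. {1..j})"
  define S where "S z = (\<Sum>(j,k)\<in>I. c / (real j)\<^sup>2 * indicator (ball (cen j k) r) z)" for z
  have disj: "(j, k) = (j', k')" if "z \<in> ball (cen j k) r" "z \<in> ball (cen j' k') r" for z j k j' k'
  proof (rule ccontr)
    assume ne: "(j, k) \<noteq> (j', k')"
    define d where "d = Complex (real j - real j') (real k - real k')"
    have "cen j k - cen j' k' = \<omega> * d"
      by (simp add: cen_def d_def complex_eq_iff algebra_simps)
    moreover have "dist (cen j k) (cen j' k') < 2 * r"
      using that dist_triangle[of "cen j k" "cen j' k'" z] by (simp add: dist_commute)
    ultimately have "cmod \<omega> * cmod d < cmod \<omega>"
      using r by (simp add: dist_norm norm_mult)
    then have "cmod d < 1"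
      using mult_left_mono[of 1 "cmod d" "cmod \<omega>"] by (smt (verit) norm_ge_zero)
    then have "\<bar>real j - real j'\<bar> < 1" "\<bar>real k - real k'\<bar> < 1"
      using abs_Re_le_cmod[of d] abs_Im_le_cmod[of d] by (simp_all add: d_def)
    then show False using ne by auto
  qed
  have S_le: "S z \<le> h z" for z
  proof (cases "\<exists>j k. (j, k) \<in> I \<and> z \<in> ball (cen j k) r")
    case True
    then obtain j k where jk: "(j, k) \<in> I" "z \<in> ball (cen j k) r" by blast
    have fin: "finite I" by (simp add: I_def)
    have "S z = (\<Sum>x\<in>{(j, k)}. case x of (j, k) \<Rightarrow> c / (real j)\<^sup>2 * indicator (ball (cen j k) r) z)"
      unfolding S_def
    proof (rule sum.mono_neutral_right[OF fin])
      show "{(j, k)} \<subseteq> I" using jk by simp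
      show "\<forall>x\<in>I - {(j, k)}. (case x of (j, k) \<Rightarrow> c / (real j)\<^sup>2 * indicator (ball (cen j k) r) z) = 0"
      proof
        fix x assume x: "x \<in> I - {(j, k)}"
        obtain j' k' where x_eq: "x = (j', k')" by (cases x)
        have "z \<notin> ball (cen j' k') r" using x disj[OF jk(2)] unfolding x_eq by blast
        then show "(case x of (j, k) \<Rightarrow> c / (real j)\<^sup>2 * indicator (ball (cen j k) r) z) = 0"
          unfolding x_eq by (simp add: indicator_def)
      qed
    qed
    also have "\<dots> = c / (real j)\<^sup>2" using jk(2) by (simp add: indicator_def)
    finally show ?thesis using lower[of k j z] jk by (simp add: I_def cen_def)
  next
    case False
    then have "S z = 0" unfolding S_def by (intro sum.neutral) (auto simp: indicator_def)
    then show ?thesis using nonneg by simp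
  qed
  have ball_int: "integrable lborel (indicator (ball x r) :: complex \<Rightarrow> real)" for x
    using emeasure_lborel_ball_finite[of x r] by (simp add: integrable_indicator_iff less_top)
  have S_int: "integrable lborel S"
    unfolding S_def split_beta by (intro Bochner_Integration.integrable_sum integrable_mult_right ball_int)
  have ball_V: "measure lborel (ball x r) = V" for x :: complex
    using r by (simp add: V_def content_ball)
  have "c * V * harm n = (\<Sum>j=1..n. c * V * inverse (real j))"
    by (simp add: harm_def sum_distrib_left)
  also have "\<dots> = (\<Sum>j=1..n. \<Sum>k=1..j. c / (real j)\<^sup>2 * V)"
    by (intro sum.cong) (simp_all add: power2_eq_square divide_simps)
  also have "\<dots> = (\<Sum>(j,k)\<in>I. c / (real j)\<^sup>2 * V)"
    unfolding I_def by (subst sum.Sigma) auto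
  also have "\<dots> = (LINT z|lborel. S z)"
    unfolding S_def split_beta
    by (subst Bochner_Integration.integral_sum)
       (auto intro!: sum.cong integrable_mult_right ball_int simp: ball_V)
  also have "\<dots> \<le> (LINT z|lborel. h z)"
    by (rule integral_mono[OF S_int int S_le])
  finally show ?thesis unfolding V_def .
qed

text \<open>
  Within distance about \<open>n\<close> of \<open>a\<close>, the factor \<open>\<bar>b - a\<bar> / \<bar>z - b\<bar>\<close> is bounded below, so that the
  density of the divided difference is comparable to that of \<open>H(z) / (z - a)\<close>.
\<close>

lemma divided_difference_lower_bound:
  fixes j k n :: nat
  defines "u \<equiv> of_nat j + \<i> * of_nat k"
  assumes jk: "1 \<le> k" "k \<le> j" "j \<le> n" and b: "b = a + \<omega> * of_nat n"
    and zero: "H a = 0" "H b = 0"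
    and \<delta>: "\<delta> > 0" "\<delta> \<le> gauss_density H z"
    and z: "cmod (z - (p + \<omega> * u)) \<le> r"
    and R: "R > 0" "cmod \<omega> + cmod (p - a) + r \<le> R" and "0 \<le> r"
  shows "\<delta> * (cmod \<omega>)\<^sup>2 / (18 * R ^ 4) / (real j)\<^sup>2 \<le> gauss_density (divided_difference H a b) z"
proof -
  have zab: "z \<noteq> a" "z \<noteq> b" using \<delta> zero by (auto simp: gauss_density_def)
  have u2: "(cmod u)\<^sup>2 = (real j)\<^sup>2 + (real k)\<^sup>2" by (simp add: u_def cmod_power2)
  have "(real k)\<^sup>2 \<le> (real j)\<^sup>2" using jk by (intro power_mono) auto
  then have u_le: "(cmod u)\<^sup>2 \<le> 2 * (real j)\<^sup>2" using u2 by simp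
  have "1 \<le> Re u" using jk by (simp add: u_def)
  then have u1: "1 \<le> cmod u" using complex_Re_le_cmod[of u] by linarith
  have "\<bar>Re u\<bar> + \<bar>Im u\<bar> = real j + real k" by (simp add: u_def)
  also have "\<dots> \<le> 2 * real n" using jk by linarith
  finally have un: "cmod u \<le> 2 * n" using cmod_le[of u] by linarith
  have "cmod (z - a) \<le> cmod (z - (p + \<omega> * u)) + cmod (p - a) + cmod (\<omega> * u)"
    using norm_triangle_ineq[of "z - (p + \<omega> * u) + (p - a)" "\<omega> * u"]
      norm_triangle_ineq[of "z - (p + \<omega> * u)" "p - a"] by simp
  also have "\<dots> \<le> (r + cmod (p - a)) * 1 + cmod \<omega> * cmod u" using z by (simp add: norm_mult)
  also have "\<dots> \<le> (r + cmod (p - a)) * cmod u + cmod \<omega> * cmod u"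
    using u1 \<open>0 \<le> r\<close> by (intro add_right_mono mult_left_mono) auto
  also have "\<dots> = (cmod \<omega> + cmod (p - a) + r) * cmod u" by (simp add: algebra_simps)
  also have "\<dots> \<le> R * cmod u" using R by (intro mult_right_mono) auto
  finally have za: "cmod (z - a) \<le> R * cmod u" .
  have ba: "cmod (b - a) = cmod \<omega> * n" by (simp add: b norm_mult)
  have "cmod (z - b) \<le> cmod (z - a) + cmod (b - a)"
    using norm_triangle_ineq4[of "z - a" "b - a"] by simp
  moreover have "R * cmod u \<le> R * (2 * n)"
    using un R by (intro mult_left_mono) auto
  moreover have "cmod \<omega> \<le> R" using R(2) \<open>0 \<le> r\<close> norm_ge_zero[of "p - a"] by linarith
  then have "cmod \<omega> * n \<le> R * n" by (intro mult_right_mono) auto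
  ultimately have zb: "cmod (z - b) \<le> 3 * R * n" using za ba by linarith
  have n: "n > 0" using jk by linarith
  have R4: "R ^ 4 = R\<^sup>2 * R\<^sup>2" by (simp add: power_add[symmetric])
  have "\<delta> * (cmod \<omega>)\<^sup>2 / (18 * R ^ 4) / (real j)\<^sup>2 = \<delta> * (cmod \<omega>)\<^sup>2 / (9 * R ^ 4 * (2 * (real j)\<^sup>2))"
    by simp
  also have "\<dots> \<le> \<delta> * (cmod \<omega>)\<^sup>2 / (9 * R ^ 4 * (cmod u)\<^sup>2)"
  proof (rule divide_left_mono)
    show "9 * R ^ 4 * (cmod u)\<^sup>2 \<le> 9 * R ^ 4 * (2 * (real j)\<^sup>2)"
      using u_le R(1) by (intro mult_left_mono) auto
    have "0 < cmod u" "0 < real j" using u1 jk by linarith+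
    then show "0 < 9 * R ^ 4 * (2 * (real j)\<^sup>2) * (9 * R ^ 4 * (cmod u)\<^sup>2)"
      using R(1) by (intro mult_pos_pos zero_less_power) auto
    show "0 \<le> \<delta> * (cmod \<omega>)\<^sup>2" using \<delta>(1) by simp
  qed
  also have "\<dots> = (\<delta> * (cmod \<omega>)\<^sup>2 * (real n)\<^sup>2) / ((9 * R ^ 4 * (cmod u)\<^sup>2) * (real n)\<^sup>2)"
    using n by simp
  also have "\<dots> = \<delta> * (cmod (b - a))\<^sup>2 / ((R * cmod u)\<^sup>2 * (3 * R * n)\<^sup>2)"
    unfolding ba power_mult_distrib R4 by (simp add: mult_ac)
  also have "\<dots> \<le> gauss_density H z * (cmod (b - a))\<^sup>2 / ((cmod (z - a))\<^sup>2 * (cmod (z - b))\<^sup>2)"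
  proof (rule frac_le)
    show "0 < (cmod (z - a))\<^sup>2 * (cmod (z - b))\<^sup>2" using zab by simp
    show "(cmod (z - a))\<^sup>2 * (cmod (z - b))\<^sup>2 \<le> (R * cmod u)\<^sup>2 * (3 * R * n)\<^sup>2"
      using za zb by (intro mult_mono power_mono) auto
    show "\<delta> * (cmod (b - a))\<^sup>2 \<le> gauss_density H z * (cmod (b - a))\<^sup>2"
      using \<delta>(2) by (rule mult_right_mono) simp
    show "0 \<le> gauss_density H z * (cmod (b - a))\<^sup>2" by simp
  qed
  also have "\<dots> = gauss_density (divided_difference H a b) z"
    using gauss_density_divided_difference[OF zab] by simp
  finally show ?thesis .
qed

text \<open>
  A nonzero doubly periodic density with a zero \<open>a\<close> is not integrable after division by \<open>\<bar>z - a\<bar>\<^sup>2\<close>. The divided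
  differences at \<open>a\<close> and \<open>a + n \<omega>\<close> approximate that situation from within Fock space. The bound \<open>C\<close>
  for the two remaining sample values is the density of \<open>H'\<close> at \<open>a\<close>.
\<close>

lemma divided_differences_escape:
  assumes hol: "H holomorphic_on UNIV" and \<omega>: "\<omega> \<noteq> 0"
    and per: "\<And>u z. u \<in> gaussian_ints \<Longrightarrow> gauss_density H (z + \<omega> * u) = gauss_density H z"
    and a: "H a = 0" and p: "H p \<noteq> 0"
  shows "\<exists>C\<ge>0. \<forall>K. \<exists>n. \<exists>f\<in>fock1. K \<le> fock1_sqnorm f \<and>
       (\<forall>z. H z = 0 \<longrightarrow> z \<noteq> a \<longrightarrow> z \<noteq> a + \<omega> * of_nat n \<longrightarrow> f z = 0) \<and>
       gauss_density f a \<le> C \<and> gauss_density f (a + \<omega> * of_nat n) \<le> C"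
proof -
  define C where "C = gauss_density (deriv H) a"
  have cont: "continuous_on UNIV (gauss_density H)" by (rule continuous_gauss_density[OF hol])
  have "\<exists>M>0. \<forall>z. gauss_density H z \<le> M"
    using per by (rule periodic_continuous_bounded[OF cont \<omega>])
  then obtain M where M: "M > 0" "\<And>z. gauss_density H z \<le> M"
    by auto
  \<comment> \<open>On the translates of a disc around \<open>p\<close> of radius \<open>r\<close>, the density of \<open>H\<close> is at least \<open>\<delta>\<close>;
    the bound on \<open>r\<close> by half the lattice spacing keeps these discs disjoint.\<close>
  define \<delta> where "\<delta> = gauss_density H p / 2"
  have \<delta>: "\<delta> > 0" using p by (simp add: \<delta>_def gauss_density_def)
  have "(gauss_density H \<longlongrightarrow> gauss_density H p) (nhds p)"
    using cont by (simp add: continuous_on_eq_continuous_at isCont_def tendsto_at_iff_tendsto_nhds)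
  then have "\<forall>\<^sub>F z in nhds p. gauss_density H z > \<delta>"
    using \<delta> by (intro order_tendstoD(1)) (auto simp: \<delta>_def)
  then obtain r0 where r0: "r0 > 0" "\<And>z. dist z p < r0 \<Longrightarrow> gauss_density H z > \<delta>"
    by (auto simp: eventually_nhds_metric)
  define r where "r = min r0 (cmod \<omega> / 2)"
  have r: "r > 0" "r \<le> r0" "2 * r \<le> cmod \<omega>" using r0 \<omega> by (auto simp: r_def)
  define R where "R = cmod \<omega> + cmod (p - a) + r"
  have R: "R > 0" using r by (simp add: R_def add_nonneg_pos)
  define c where "c = \<delta> * (cmod \<omega>)\<^sup>2 / (18 * R ^ 4)"
  have c: "c > 0" using \<delta> \<omega> R by (simp add: c_def)
  define V where "V = measure lborel (ball (0::complex) r)"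
  have V: "V > 0" using r by (simp add: V_def content_ball)
  have u_int: "of_nat j + \<i> * of_nat k \<in> gaussian_ints" for j k :: nat
    unfolding gaussian_ints_def by (rule CollectI, intro exI[of _ "int j"] exI[of _ "int k"]) simp
  have "\<exists>n. \<exists>f\<in>fock1. K \<le> fock1_sqnorm f \<and>
       (\<forall>z. H z = 0 \<longrightarrow> z \<noteq> a \<longrightarrow> z \<noteq> a + \<omega> * of_nat n \<longrightarrow> f z = 0) \<and>
       gauss_density f a \<le> C \<and> gauss_density f (a + \<omega> * of_nat n) \<le> C" for K
  proof -
    have "eventually (\<lambda>n. harm n \<ge> K / (c * V)) sequentially"
      using harm_at_top by (simp add: filterlim_at_top)
    moreover have "eventually (\<lambda>n::nat. n \<ge> 1) sequentially" by (rule eventually_ge_at_top)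
    ultimately have "eventually (\<lambda>n. harm n \<ge> K / (c * V) \<and> n \<ge> 1) sequentially"
      by (rule eventually_conj)
    \<comment> \<open>The integral grows at least like the harmonic numbers, with slope \<open>c V\<close>.\<close>
    then obtain n where n: "harm n \<ge> K / (c * V)" "n \<ge> 1"
      using eventually_happens' sequentially_bot by blast
    define b where "b = a + \<omega> * of_nat n"
    define f where "f = divided_difference H a b"
    have n_int: "of_nat n \<in> gaussian_ints" using u_int[of n 0] by simp
    have ab: "a \<noteq> b" using \<omega> n by (simp add: b_def)
    have "gauss_density H b = 0" using per[OF n_int, of a] a by (simp add: b_def gauss_density_def)
    then have b: "H b = 0" by (simp add: gauss_density_def)
    have f_hol: "f holomorphic_on UNIV"
      unfolding f_def by (rule divided_difference_holomorphic[OF hol a b])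
    have f_int: "integrable lborel (gauss_density f)"
      unfolding f_def by (rule integrable_divided_difference[OF hol a b M])
    have "c / (real j)\<^sup>2 \<le> gauss_density f z"
      if jk: "1 \<le> k" "k \<le> j" "j \<le> n"
        and z: "z \<in> ball (p + \<omega> * (of_nat j + \<i> * of_nat k)) r" for j k z
      unfolding c_def f_def
    proof (rule divided_difference_lower_bound[OF jk b_def a b \<delta>])
      have zr: "cmod (z - (p + \<omega> * (of_nat j + \<i> * of_nat k))) < r"
        using z by (simp add: dist_norm norm_minus_commute)
      then have "dist (z - \<omega> * (of_nat j + \<i> * of_nat k)) p < r0"
        using r by (simp add: dist_norm algebra_simps)
      from r0(2)[OF this] show "\<delta> \<le> gauss_density H z"
        using per[OF u_int, of "z - \<omega> * (of_nat j + \<i> * of_nat k)" j k] by simp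
      show "cmod (z - (p + \<omega> * (of_nat j + \<i> * of_nat k))) \<le> r" using zr by simp
    qed (use R r in \<open>auto simp: R_def\<close>)
    then have "c * V * harm n \<le> (LINT z|lborel. gauss_density f z)"
      unfolding V_def by (intro integral_ge_harmonic_of_lattice_balls[where \<omega>=\<omega> and p=p] f_int r) auto
    moreover have "K \<le> c * V * harm n"
      using n c V by (simp add: field_simps)
    ultimately have big: "K \<le> (LINT z|lborel. gauss_density f z)" by linarith
    have vanish: "f z = 0" if "H z = 0" "z \<noteq> a" "z \<noteq> b" for z
      using divided_difference_eq[OF that(2,3)] that by (simp add: f_def)
    have at_a: "gauss_density f a = C"
      unfolding f_def C_def by (rule gauss_density_divided_difference_at_zero[OF a b ab])
    have "gauss_density f b = gauss_density (deriv H) b"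
      unfolding f_def by (rule gauss_density_divided_difference_at_zero[OF a b ab])
    also have "\<dots> = C"
      unfolding C_def b_def using per[OF n_int] by (intro gauss_density_deriv_periodic hol a)
    finally have at_b: "gauss_density f b = C" .
    show ?thesis
      using f_hol f_int big vanish at_a at_b unfolding b_def
      by (intro exI[of _ n] bexI[of _ f]) (auto simp: fock1_def fock1_sqnorm_def)
  qed
  moreover have "C \<ge> 0" by (simp add: C_def)
  ultimately show ?thesis by blast
qed

section \<open>A function vanishing on a punctured lattice\<close>

text \<open>
  Each zero set is countable, hence their finite union is not the whole plane.
\<close>

lemma entire_family_common_nonzero:
  assumes "finite I"
    and hol: "\<And>i. i \<in> I \<Longrightarrow> f i holomorphic_on UNIV"
    and nz: "\<And>i. i \<in> I \<Longrightarrow> \<exists>z. f i z \<noteq> 0"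
  obtains p where "\<And>i. i \<in> I \<Longrightarrow> f i p \<noteq> 0"
proof -
  have "countable {z. f i z = 0}" if i: "i \<in> I" for i
  proof (cases "f i constant_on UNIV")
    case True
    then show ?thesis using nz[OF i] by (auto simp: constant_on_def)
  next
    case False
    then show ?thesis using holomorphic_countable_zeros[OF hol[OF i]] connected_UNIV by simp
  qed
  then have "countable (\<Union>i\<in>I. {z. f i z = 0})"
    using \<open>finite I\<close> by (intro countable_UN) (auto intro: countable_finite)
  then have "(\<Union>i\<in>I. {z. f i z = 0}) \<noteq> UNIV"
    using uncountable_UNIV_complex by metis
  then show ?thesis using that by blast
qed

text \<open>
  The Fock space translate of \<open>fock_sigma\<close>, up to a constant factor: the exponential multiplier makes
  the density translate along with the argument.
\<close>

definition shifted_sigma :: "complex \<Rightarrow> complex \<Rightarrow> complex" where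
  "shifted_sigma c z = exp (of_real pi * (z * cnj c)) * fock_sigma (z - c)"

lemma gauss_density_shifted_sigma:
  "gauss_density (shifted_sigma c) z = exp (pi * (cmod c)\<^sup>2) * gauss_density fock_sigma (z - c)"
proof -
  have "(cmod (z - c))\<^sup>2 = (cmod z)\<^sup>2 + (cmod c)\<^sup>2 - 2 * Re (z * cnj c)"
    unfolding cmod_power2 by (simp add: power2_eq_square algebra_simps)
  then have "2 * (pi * Re (z * cnj c)) + - pi * (cmod z)\<^sup>2
      = pi * (cmod c)\<^sup>2 + - pi * (cmod (z - c))\<^sup>2"
    by (simp only:) (simp add: algebra_simps)
  then have "exp (pi * Re (z * cnj c)) ^ 2 * exp (- pi * (cmod z)\<^sup>2)
      = exp (pi * (cmod c)\<^sup>2) * exp (- pi * (cmod (z - c))\<^sup>2)"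
    by (simp only: exp_double[symmetric] exp_add[symmetric])
  moreover have "cmod (shifted_sigma c z) = exp (pi * Re (z * cnj c)) * cmod (fock_sigma (z - c))"
    by (simp add: shifted_sigma_def norm_mult)
  ultimately show ?thesis
    unfolding gauss_density_def by (simp add: power_mult_distrib mult_ac)
qed

lemma shifted_sigma_holomorphic: "shifted_sigma c holomorphic_on UNIV"
proof -
  have "(\<lambda>z. fock_sigma (z - c)) holomorphic_on UNIV"
    using holomorphic_on_compose_gen[of "\<lambda>z. z - c" UNIV fock_sigma UNIV, OF _ fock_sigma_holomorphic]
    by (simp add: o_def holomorphic_on_diff)
  then show ?thesis
    unfolding shifted_sigma_def by (intro holomorphic_intros)
qed

text \<open>
  The rescaling by \<open>\<kappa>\<close> is chosen such that the Gaussian weights of the factors multiply to the weight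
  of the product.
\<close>

lemma gauss_density_prod_rescaled:
  assumes "finite R" and "real (card R) * (cmod \<kappa>)\<^sup>2 = 1"
  shows "gauss_density (\<lambda>z. \<Prod>r\<in>R. F r (\<kappa> * z)) z = (\<Prod>r\<in>R. gauss_density (F r) (\<kappa> * z))"
proof -
  have "(\<Prod>r\<in>R. gauss_density (F r) (\<kappa> * z))
      = (\<Prod>r\<in>R. (cmod (F r (\<kappa> * z)))\<^sup>2) * exp (- pi * (cmod (\<kappa> * z))\<^sup>2) ^ card R"
    by (simp add: gauss_density_def prod.distrib)
  also have "exp (- pi * (cmod (\<kappa> * z))\<^sup>2) ^ card R
      = exp (- pi * (real (card R) * (cmod \<kappa>)\<^sup>2 * (cmod z)\<^sup>2))"
    by (simp add: exp_of_nat_mult[symmetric] norm_mult power_mult_distrib mult_ac)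
  finally show ?thesis
    by (simp add: gauss_density_def assms(2) prod_norm[symmetric] prod_power_distrib)
qed

text \<open>
  The factors are sigma functions for the cosets \<open>\<gamma> (r + q \<int>[\<i>])\<close>, one for each nonzero residue \<open>r\<close>
  modulo \<open>q\<close>. After rescaling by \<open>\<kappa> = 1 / (\<gamma> q)\<close>, these cosets become translates of \<open>\<int>[\<i>]\<close>. The
  relation between \<open>\<gamma>\<close> and \<open>q\<close> says exactly that \<open>\<bar>q\<bar>\<^sup>2 - 1\<close> such factors have the critical growth of
  Fock space.
\<close>

lemma punctured_lattice_function:
  assumes q: "q \<in> gaussian_ints" "cmod q \<ge> 2" and \<gamma>: "\<gamma>\<^sup>2 + 1 / (cmod q)\<^sup>2 = 1"
  obtains G p where "G holomorphic_on UNIV" "G p \<noteq> 0"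
    "\<And>u z. u \<in> gaussian_ints \<Longrightarrow> gauss_density G (z + of_real \<gamma> * q * u) = gauss_density G z"
    "\<And>n. n \<in> gaussian_ints \<Longrightarrow> n / q \<notin> gaussian_ints \<Longrightarrow> G (of_real \<gamma> * n) = 0"
proof -
  have q0: "q \<noteq> 0" using q(2) by auto
  have N4: "(cmod q)\<^sup>2 \<ge> 4" using power_mono[OF q(2), of 2] by simp
  then have "1 / (cmod q)\<^sup>2 < 1" by (simp add: divide_less_eq)
  then have \<gamma>0: "\<gamma> \<noteq> 0" using \<gamma> by auto
  have \<gamma>N: "\<gamma>\<^sup>2 * (cmod q)\<^sup>2 = (cmod q)\<^sup>2 - 1"
    using \<gamma> q0 by (simp add: field_simps)
  obtain R where R: "finite R" "R \<subseteq> gaussian_ints" "real (card R) + 1 = (cmod q)\<^sup>2"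
    and cover: "\<And>n. n \<in> gaussian_ints \<Longrightarrow> n / q \<notin> gaussian_ints \<Longrightarrow> \<exists>r\<in>R. (n - r) / q \<in> gaussian_ints"
    using gaussian_nonzero_residues[OF q(1) q0] by metis
  define \<kappa> where "\<kappa> = 1 / (of_real \<gamma> * q)"
  have \<kappa>0: "\<kappa> \<noteq> 0" using \<gamma>0 q0 by (simp add: \<kappa>_def)
  have "(cmod \<kappa>)\<^sup>2 = 1 / (\<gamma>\<^sup>2 * (cmod q)\<^sup>2)"
    by (simp add: \<kappa>_def norm_divide norm_mult power_divide power_mult_distrib)
  then have card_\<kappa>: "real (card R) * (cmod \<kappa>)\<^sup>2 = 1"
    using \<gamma>N R(3) N4 by simp
  define G where "G z = (\<Prod>r\<in>R. shifted_sigma (r / q) (\<kappa> * z))" for z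
  have factor_hol: "(\<lambda>z. shifted_sigma c (\<kappa> * z)) holomorphic_on UNIV" for c
    using holomorphic_on_compose_gen[of "\<lambda>z. \<kappa> * z" UNIV "shifted_sigma c" UNIV, OF _ shifted_sigma_holomorphic]
    by (simp add: o_def holomorphic_on_mult)
  have G_hol: "G holomorphic_on UNIV"
    unfolding G_def by (intro holomorphic_intros factor_hol)
  have dens: "gauss_density G z =
      (\<Prod>r\<in>R. exp (pi * (cmod (r / q))\<^sup>2) * gauss_density fock_sigma (\<kappa> * z - r / q))" for z
    unfolding G_def gauss_density_shifted_sigma[symmetric]
    using gauss_density_prod_rescaled[OF R(1) card_\<kappa>, of "\<lambda>r. shifted_sigma (r / q)"] by simp
  have per: "gauss_density G (z + of_real \<gamma> * q * u) = gauss_density G z"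
    if u: "u \<in> gaussian_ints" for u z
  proof -
    have "\<kappa> * (z + of_real \<gamma> * q * u) = \<kappa> * z + u"
      using \<gamma>0 q0 by (simp add: \<kappa>_def field_simps)
    then have "\<kappa> * (z + of_real \<gamma> * q * u) - r / q = \<kappa> * z - r / q + u" for r by simp
    then show ?thesis by (simp only: dens fock_sigma_density_periodic[OF u])
  qed
  have zero: "G (of_real \<gamma> * n) = 0"
    if n: "n \<in> gaussian_ints" "n / q \<notin> gaussian_ints" for n
  proof -
    obtain r where r: "r \<in> R" "(n - r) / q \<in> gaussian_ints" using cover[OF n] by blast
    have "\<kappa> * (of_real \<gamma> * n) - r / q = (n - r) / q"
      using \<gamma>0 q0 by (simp add: \<kappa>_def field_simps)
    then have "shifted_sigma (r / q) (\<kappa> * (of_real \<gamma> * n)) = 0"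
      using fock_sigma_gaussian_int[OF r(2)] by (simp add: shifted_sigma_def)
    then show ?thesis unfolding G_def using r(1) R(1) by (intro prod_zero) auto
  qed
  have "\<exists>z. shifted_sigma c (\<kappa> * z) \<noteq> 0" for c
    using \<kappa>0 fock_sigma_nonzero
    by (intro exI[of _ "(c - 1/2) / \<kappa>"]) (simp add: shifted_sigma_def)
  then obtain p where "\<And>r. r \<in> R \<Longrightarrow> shifted_sigma (r / q) (\<kappa> * p) \<noteq> 0"
    using entire_family_common_nonzero[OF R(1), of "\<lambda>r z. shifted_sigma (r / q) (\<kappa> * z)"] factor_hol
    by blast
  then have "G p \<noteq> 0" using R(1) by (simp add: G_def)
  then show ?thesis using that G_hol per zero by blast
qed

section \<open>Tensor products in the two-variable Fock space\<close>

definition pair_vec :: "complex \<times> complex \<Rightarrow> complex ^ 2" where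
  "pair_vec p = (\<chi> i. if i = 1 then fst p else snd p)"

lemma pair_vec_nth [simp]: "pair_vec p $ 1 = fst p" "pair_vec p $ 2 = snd p"
  by (simp_all add: pair_vec_def)

lemma pair_vec_eq_iff: "pair_vec p = z \<longleftrightarrow> p = (z $ 1, z $ 2)"
  by (auto simp: vec_eq_iff forall_2 prod_eq_iff)

lemma measurable_pair_vec [measurable]: "pair_vec \<in> borel \<rightarrow>\<^sub>M borel"
proof (rule borel_measurable_continuous_onI)
  have "continuous_on UNIV (\<lambda>p::complex \<times> complex. if i = 1 then fst p else snd p)" for i :: 2
    by (cases "i = 1") (auto intro: continuous_intros)
  then show "continuous_on UNIV pair_vec"
    unfolding pair_vec_def by (rule continuous_on_vec_lambda)
qed

lemma Basis_complex_vec_2: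
  "(Basis :: (complex ^ 2) set) = axis 1 ` Basis \<union> axis 2 ` Basis"
  by (auto simp: Basis_vec_def UNIV_2)

text \<open>
  Identifies \<open>\<complex>\<^sup>2\<close>, as a type of vectors, with a product of two copies of \<open>\<complex>\<close>, so that the theorem of
  Fubini applies.
\<close>

lemma lborel_complex_vec_2:
  "distr (lborel \<Otimes>\<^sub>M lborel) borel pair_vec = (lborel :: (complex ^ 2) measure)"
proof (rule lborel_eqI[symmetric])
  fix l u :: "complex ^ 2"
  assume lu: "\<And>b. b \<in> Basis \<Longrightarrow> l \<bullet> b \<le> u \<bullet> b"
  have lu_i: "(l $ i) \<bullet> b \<le> (u $ i) \<bullet> b" if "b \<in> Basis" for i b
    using lu[of "axis i b"] that by (simp add: inner_axis axis_in_Basis_iff)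
  have box: "pair_vec -` box l u = box (l $ 1) (u $ 1) \<times> box (l $ 2) (u $ 2)"
    unfolding box_def Basis_complex_vec_2 by (auto simp: inner_axis ball_Un)
  have inj: "inj_on (axis i) (Basis :: complex set)" for i :: 2
    by (auto simp: inj_on_def axis_eq_axis)
  have disj: "axis 1 ` Basis \<inter> axis 2 ` (Basis :: complex set) = ({} :: (complex ^ 2) set)"
    by (auto simp: axis_eq_axis)
  have "emeasure (distr (lborel \<Otimes>\<^sub>M lborel) borel pair_vec) (box l u)
      = emeasure (lborel \<Otimes>\<^sub>M lborel) (box (l $ 1) (u $ 1) \<times> box (l $ 2) (u $ 2))"
    by (subst emeasure_distr) (simp_all add: lborel_prod box space_pair_measure)
  also have "\<dots> = emeasure lborel (box (l $ 1) (u $ 1)) * emeasure lborel (box (l $ 2) (u $ 2))"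
    by (rule lborel.emeasure_pair_measure_Times) auto
  also have "\<dots> = ennreal (\<Prod>b\<in>Basis. (u - l) $ 1 \<bullet> b) * ennreal (\<Prod>b\<in>Basis. (u - l) $ 2 \<bullet> b)"
    by (simp add: emeasure_lborel_box lu_i)
  also have "\<dots> = ennreal ((\<Prod>b\<in>Basis. (u - l) $ 1 \<bullet> b) * (\<Prod>b\<in>Basis. (u - l) $ 2 \<bullet> b))"
    by (rule ennreal_mult[symmetric]) (auto intro!: prod_nonneg simp: inner_diff_left lu_i)
  also have "(\<Prod>b\<in>Basis. (u - l) $ 1 \<bullet> b) * (\<Prod>b\<in>Basis. (u - l) $ 2 \<bullet> b) = (\<Prod>b\<in>Basis. (u - l) \<bullet> b)"
    unfolding Basis_complex_vec_2
    by (subst prod.union_disjoint) (auto simp: disj prod.reindex[OF inj] inner_axis)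
  finally show "emeasure (distr (lborel \<Otimes>\<^sub>M lborel) borel pair_vec) (box l u) = (\<Prod>b\<in>Basis. (u - l) \<bullet> b)" .
qed simp

lemma tensor_product_integral:
  fixes f g :: "complex \<Rightarrow> real"
  assumes f: "integrable lborel f" and g: "integrable lborel g"
  shows "integrable lborel (\<lambda>z :: complex ^ 2. f (z $ 1) * g (z $ 2))"
    and "(LINT z|lborel. f ((z :: complex ^ 2) $ 1) * g (z $ 2)) = (LINT x|lborel. f x) * (LINT y|lborel. g y)"
proof -
  have [measurable]: "f \<in> borel_measurable borel" "g \<in> borel_measurable borel"
    using f g by (auto dest: borel_measurable_integrable)
  have nth_meas [measurable]: "(\<lambda>z :: complex ^ 2. z $ i) \<in> borel \<rightarrow>\<^sub>M borel" for i
    by (intro borel_measurable_continuous_onI continuous_intros)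
  have pv [measurable]: "pair_vec \<in> (lborel \<Otimes>\<^sub>M lborel) \<rightarrow>\<^sub>M borel"
    by (simp add: lborel_prod)
  have pair_int: "integrable (lborel \<Otimes>\<^sub>M lborel) (\<lambda>p. f (fst p) * g (snd p))"
  proof (rule lborel_pair.Fubini_integrable)
    show "integrable lborel (\<lambda>x. LINT y|lborel. norm (f (fst (x, y)) * g (snd (x, y))))"
      using f g by (simp add: abs_mult)
    show "AE x in lborel. integrable lborel (\<lambda>y. f (fst (x, y)) * g (snd (x, y)))"
      using g by simp
  qed measurable
  show "integrable lborel (\<lambda>z :: complex ^ 2. f (z $ 1) * g (z $ 2))"
    unfolding lborel_complex_vec_2[symmetric]
    using pair_int by (subst integrable_distr_eq) auto
  have "(LINT z|lborel. f ((z :: complex ^ 2) $ 1) * g (z $ 2))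
      = (LINT p|(lborel \<Otimes>\<^sub>M lborel). f (fst p) * g (snd p))"
    unfolding lborel_complex_vec_2[symmetric] by (subst integral_distr) auto
  also have "\<dots> = (LINT x|lborel. LINT y|lborel. f x * g y)"
    using lborel_pair.integral_fst'[OF pair_int] by simp
  finally show "(LINT z|lborel. f ((z :: complex ^ 2) $ 1) * g (z $ 2)) = (LINT x|lborel. f x) * (LINT y|lborel. g y)"
    by simp
qed

definition tensor :: "(complex \<Rightarrow> complex) \<Rightarrow> (complex \<Rightarrow> complex) \<Rightarrow> complex ^ 2 \<Rightarrow> complex" where
  "tensor f g z = f (z $ 1) * g (z $ 2)"

lemma tensor_density:
  "(cmod (tensor f g z))\<^sup>2 * exp (- pi * (norm z)\<^sup>2) = gauss_density f (z $ 1) * gauss_density g (z $ 2)"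
proof -
  have "(norm z)\<^sup>2 = (cmod (z $ 1))\<^sup>2 + (cmod (z $ 2))\<^sup>2"
    by (simp add: norm_vec_def L2_set_def sum_2)
  then have "exp (- pi * (norm z)\<^sup>2) = exp (- pi * (cmod (z $ 1))\<^sup>2) * exp (- pi * (cmod (z $ 2))\<^sup>2)"
    by (simp add: exp_add[symmetric] algebra_simps)
  then show ?thesis
    by (simp add: tensor_def gauss_density_def norm_mult power_mult_distrib)
qed

lemma tensor_entire:
  assumes f: "f holomorphic_on UNIV" and g: "g holomorphic_on UNIV"
  shows "entire (tensor f g)"
  unfolding entire_def
proof
  fix z :: "complex ^ 2"
  have nth: "((\<lambda>z :: complex ^ 2. z $ i) has_derivative (\<lambda>h. h $ i)) (at z)" for i
    by (rule bounded_linear_imp_has_derivative[OF bounded_linear_vec_nth])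
  have "(f has_derivative (*) (deriv f (z $ 1))) (at (z $ 1))"
    using f by (simp add: holomorphic_derivI flip: has_field_derivative_def)
  from has_derivative_compose[OF nth this]
  have f': "((\<lambda>z. f (z $ 1)) has_derivative (\<lambda>h. deriv f (z $ 1) * h $ 1)) (at z)" .
  have "(g has_derivative (*) (deriv g (z $ 2))) (at (z $ 2))"
    using g by (simp add: holomorphic_derivI flip: has_field_derivative_def)
  from has_derivative_compose[OF nth this]
  have g': "((\<lambda>z. g (z $ 2)) has_derivative (\<lambda>h. deriv g (z $ 2) * h $ 2)) (at z)" .
  show "\<exists>D. (tensor f g has_derivative D) (at z) \<and> (\<forall>c h. D (c *s h) = c * D h)"
    unfolding tensor_def[abs_def]
    by (intro exI conjI, rule has_derivative_mult[OF f' g']) (simp add: algebra_simps)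
qed

lemma tensor_fock_space:
  assumes "f \<in> fock1" "g \<in> fock1"
  shows "tensor f g \<in> fock_space"
    and "(fock_norm (tensor f g))\<^sup>2 = fock1_sqnorm f * fock1_sqnorm g"
proof -
  have f: "f holomorphic_on UNIV" "integrable lborel (gauss_density f)"
    and g: "g holomorphic_on UNIV" "integrable lborel (gauss_density g)"
    using assms by (auto simp: fock1_def)
  show "tensor f g \<in> fock_space"
    unfolding fock_space_def mem_Collect_eq tensor_density
    using tensor_entire[OF f(1) g(1)] tensor_product_integral(1)[OF f(2) g(2)] by blast
  show "(fock_norm (tensor f g))\<^sup>2 = fock1_sqnorm f * fock1_sqnorm g"
    unfolding fock_norm_def tensor_density tensor_product_integral(2)[OF f(2) g(2)]
      fock1_sqnorm_def[symmetric]
    by (intro real_sqrt_pow2 mult_nonneg_nonneg fock1_sqnorm_nonneg)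
qed

text \<open>
  From \<open>1 + x \<le> exp x\<close>, squared, and \<open>2 \<le> \<pi>\<close>.
\<close>

lemma one_in_fock1: "(\<lambda>_. 1) \<in> fock1"
  unfolding fock1_def
proof (intro CollectI conjI, simp, rule integrable_lborel_of_decay[where R = 0 and C = 1])
  show "continuous_on UNIV (gauss_density (\<lambda>_. 1))"
    by (rule continuous_gauss_density) simp
  fix z :: complex
  let ?x = "(cmod z)\<^sup>2"
  have "1 + ?x \<le> exp ?x" by (rule exp_ge_add_one_self)
  then have "(1 + ?x)\<^sup>2 \<le> exp ?x ^ 2" by (intro power_mono) (auto simp: add_nonneg_nonneg)
  also have "\<dots> \<le> exp (pi * ?x)"
    using pi_ge_two by (simp add: exp_double[symmetric] mult_right_mono)
  finally have "(1 + ?x)\<^sup>2 \<le> exp (pi * ?x)" .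
  moreover have "0 < (1 + ?x)\<^sup>2" by (intro zero_less_power add_pos_nonneg) auto
  ultimately show "\<bar>gauss_density (\<lambda>_. 1) z\<bar> \<le> 1 / (1 + ?x)\<^sup>2"
    by (simp add: gauss_density_def exp_minus divide_inverse le_imp_inverse_le)
qed

lemma sampling_set_tensor:
  fixes \<Lambda> :: "(complex ^ 2) set"
  assumes "sampling_set \<Lambda>"
  shows "\<exists>A>0. \<exists>B>0. \<forall>f\<in>fock1. \<forall>g\<in>fock1.
    (\<lambda>z. gauss_density f (z $ 1) * gauss_density g (z $ 2)) summable_on \<Lambda> \<and>
    A * (fock1_sqnorm f * fock1_sqnorm g)
      \<le> (\<Sum>\<^sub>\<infinity>z\<in>\<Lambda>. gauss_density f (z $ 1) * gauss_density g (z $ 2)) \<and>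
    (\<Sum>\<^sub>\<infinity>z\<in>\<Lambda>. gauss_density f (z $ 1) * gauss_density g (z $ 2))
      \<le> B * (fock1_sqnorm f * fock1_sqnorm g)"
proof -
  obtain A B where AB: "A > 0" "B > 0"
    and samp: "\<And>F. F \<in> fock_space \<Longrightarrow>
        (\<lambda>l. (cmod (F l))\<^sup>2 * exp (- pi * (norm l)\<^sup>2)) summable_on \<Lambda> \<and>
        A * (fock_norm F)\<^sup>2 \<le> (\<Sum>\<^sub>\<infinity>l\<in>\<Lambda>. (cmod (F l))\<^sup>2 * exp (- pi * (norm l)\<^sup>2)) \<and>
        (\<Sum>\<^sub>\<infinity>l\<in>\<Lambda>. (cmod (F l))\<^sup>2 * exp (- pi * (norm l)\<^sup>2)) \<le> B * (fock_norm F)\<^sup>2"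
    using assms unfolding sampling_set_def by blast
  show ?thesis
  proof (rule exI[of _ A], rule conjI[OF AB(1)], rule exI[of _ B], rule conjI[OF AB(2)],
      intro ballI conjI)
    fix f g assume fg: "f \<in> fock1" "g \<in> fock1"
    note * = samp[OF tensor_fock_space(1)[OF fg], unfolded tensor_density tensor_fock_space(2)[OF fg]]
    from * show "(\<lambda>z. gauss_density f (z $ 1) * gauss_density g (z $ 2)) summable_on \<Lambda>" by blast
    from * show "A * (fock1_sqnorm f * fock1_sqnorm g)
      \<le> (\<Sum>\<^sub>\<infinity>z\<in>\<Lambda>. gauss_density f (z $ 1) * gauss_density g (z $ 2))" by blast
    from * show "(\<Sum>\<^sub>\<infinity>z\<in>\<Lambda>. gauss_density f (z $ 1) * gauss_density g (z $ 2))
      \<le> B * (fock1_sqnorm f * fock1_sqnorm g)" by blast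
  qed
qed

section \<open>Sums over slices of the lattice\<close>

lemma infsum_Un_le:
  fixes w :: "'a \<Rightarrow> real"
  assumes "w summable_on A" "w summable_on B" "\<And>x. w x \<ge> 0"
  shows "w summable_on (A \<union> B)" and "infsum w (A \<union> B) \<le> infsum w A + infsum w B"
proof -
  have BA: "w summable_on (B - A)" by (rule summable_on_subset_banach[OF assms(2)]) auto
  have eq: "A \<union> B = A \<union> (B - A)" by auto
  show "w summable_on (A \<union> B)"
    unfolding eq by (rule summable_on_Un_disjoint[OF assms(1) BA]) auto
  have "infsum w (A \<union> B) = infsum w A + infsum w (B - A)"
    unfolding eq by (rule infsum_Un_disjoint[OF assms(1) BA]) auto
  moreover have "infsum w (B - A) \<le> infsum w B"
    by (rule infsum_mono2[OF BA assms(2)]) (use assms(3) in auto)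
  ultimately show "infsum w (A \<union> B) \<le> infsum w A + infsum w B" by simp
qed

text \<open>
  For sums of product densities along a row or column: the fixed coordinate contributes the factor \<open>c\<close>.
\<close>

lemma infsum_scaled_slice_le:
  fixes w :: "'a \<Rightarrow> real" and \<phi> :: "'b \<Rightarrow> real"
  assumes inj: "inj_on h Y" and eq: "\<And>y. y \<in> Y \<Longrightarrow> w (h y) = c * \<phi> y"
    and \<phi>: "\<phi> summable_on Y" "infsum \<phi> Y \<le> D" and c: "0 \<le> c" "c \<le> C" "0 \<le> D"
  shows "w summable_on h ` Y" and "infsum w (h ` Y) \<le> C * D"
proof -
  have "(w \<circ> h) summable_on Y \<longleftrightarrow> (\<lambda>y. c * \<phi> y) summable_on Y"
    by (rule summable_on_cong) (simp add: eq)
  then show "w summable_on h ` Y"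
    by (simp add: summable_on_reindex[OF inj] summable_on_cmult_right \<phi>)
  have "infsum w (h ` Y) = (\<Sum>\<^sub>\<infinity>y\<in>Y. c * \<phi> y)"
    unfolding infsum_reindex[OF inj] by (rule infsum_cong) (simp add: eq)
  also have "\<dots> = c * infsum \<phi> Y" using \<phi> by (simp add: infsum_cmult_right)
  also have "\<dots> \<le> C * D"
    using \<phi> c by (meson mult_left_mono mult_right_mono order_trans)
  finally show "infsum w (h ` Y) \<le> C * D" .
qed

text \<open>
  The converse use of slices: a bound for the sum over all of \<open>\<Lambda>\<close> bounds the sum over a row or column
  contained in it. This lets the upper sampling inequality provide the one-variable bounds.
\<close>

lemma slice_sum_le:
  assumes sub: "h ` Y \<subseteq> \<Lambda>" and inj: "inj_on h Y"
    and B: "w summable_on \<Lambda>" "infsum w \<Lambda> \<le> B" and nonneg: "\<And>x. w x \<ge> (0::real)"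
    and eq: "\<And>y. y \<in> Y \<Longrightarrow> w (h y) = c * \<phi> y" and c: "c > 0"
  shows "\<phi> summable_on Y" and "infsum \<phi> Y \<le> B / c"
proof -
  have sum: "w summable_on h ` Y" by (rule summable_on_subset_banach[OF B(1) sub])
  have \<phi>_eq: "\<phi> y = (w \<circ> h) y * (1 / c)" if "y \<in> Y" for y using eq[OF that] c by simp
  have wh: "(w \<circ> h) summable_on Y" using sum by (simp add: summable_on_reindex[OF inj])
  have "\<phi> summable_on Y \<longleftrightarrow> (\<lambda>y. (w \<circ> h) y * (1 / c)) summable_on Y"
    by (rule summable_on_cong) (rule \<phi>_eq)
  then show "\<phi> summable_on Y" using summable_on_cmult_left[OF wh] by blast
  have "infsum \<phi> Y = (\<Sum>\<^sub>\<infinity>y\<in>Y. (w \<circ> h) y * (1 / c))" by (rule infsum_cong) (rule \<phi>_eq)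
  also have "\<dots> = infsum w (h ` Y) * (1 / c)"
    unfolding infsum_reindex[OF inj] using wh by (rule infsum_cmult_left)
  also have "\<dots> \<le> infsum w \<Lambda> * (1 / c)"
    using c by (intro mult_right_mono infsum_mono2[OF sum B(1) sub]) (use nonneg in auto)
  also have "\<dots> \<le> B / c" using B(2) c by (simp add: divide_right_mono)
  finally show "infsum \<phi> Y \<le> B / c" .
qed
lemma gaussian_lattice_upper_triangular:
  "gaussian_lattice (vector [vector [1, 1 / q], vector [0, c]] :: complex ^ 2 ^ 2)
    = {pair_vec (m + n / q, c * n) | m n. m \<in> gaussian_ints \<and> n \<in> gaussian_ints}"
proof -
  have mult: "(vector [vector [1, 1 / q], vector [0, c]] :: complex ^ 2 ^ 2) *v x
      = pair_vec (x $ 1 + x $ 2 / q, c * x $ 2)" for x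
    by (simp add: vec_eq_iff forall_2 matrix_vector_mult_def sum_2)
  show ?thesis
    unfolding gaussian_lattice_def mult
  proof (intro equalityI subsetI)
    fix v assume "v \<in> {pair_vec (m + n / q, c * n) | m n. m \<in> gaussian_ints \<and> n \<in> gaussian_ints}"
    then obtain m n where "v = pair_vec (m + n / q, c * n)" "m \<in> gaussian_ints" "n \<in> gaussian_ints"
      by blast
    then show "v \<in> (\<lambda>x :: complex ^ 2. pair_vec (x $ 1 + x $ 2 / q, c * x $ 2)) ` {x. \<forall>i. x $ i \<in> gaussian_ints}"
      by (intro image_eqI[of _ _ "pair_vec (m, n)"]) (auto simp: forall_2)
  qed auto
qed

section \<open>Failure of the sampling inequality\<close>

theorem theorem4p1:
  fixes q :: complex and \<gamma> :: real and \<Lambda> :: "(complex ^ 2) set"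
  assumes "q \<in> gaussian_ints" and "cmod q \<ge> 2"
    and "\<gamma>\<^sup>2 + 1 / (cmod q)\<^sup>2 = 1"
    and "\<Lambda> = gaussian_lattice
           (vector [vector [1, 1 / q],
                    vector [0, complex_of_real \<gamma>]])"
  shows "\<not> sampling_set \<Lambda>"
proof
  assume "sampling_set \<Lambda>"
  define c where "c = complex_of_real \<gamma>"
  define w where "w f g z = gauss_density f (z $ 1) * gauss_density g (z $ 2)"
    for f g :: "complex \<Rightarrow> complex" and z :: "complex ^ 2"
  have w_nonneg: "w f g z \<ge> 0" for f g z by (simp add: w_def)
  obtain A B where AB: "A > 0" "B > 0"
    and samp: "\<And>f g. f \<in> fock1 \<Longrightarrow> g \<in> fock1 \<Longrightarrow> w f g summable_on \<Lambda>"
      "\<And>f g. f \<in> fock1 \<Longrightarrow> g \<in> fock1 \<Longrightarrow> A * (fock1_sqnorm f * fock1_sqnorm g) \<le> infsum (w f g) \<Lambda>"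
      "\<And>f g. f \<in> fock1 \<Longrightarrow> g \<in> fock1 \<Longrightarrow> infsum (w f g) \<Lambda> \<le> B * (fock1_sqnorm f * fock1_sqnorm g)"
    using sampling_set_tensor[OF \<open>sampling_set \<Lambda>\<close>] unfolding w_def[abs_def] by blast
  have q0: "q \<noteq> 0" using assms(2) by auto
  have N4: "(cmod q)\<^sup>2 \<ge> 4" using power_mono[OF assms(2), of 2] by simp
  then have "1 / (cmod q)\<^sup>2 < 1" by (simp add: divide_less_eq)
  then have c0: "c \<noteq> 0" using assms(3) by (auto simp: c_def)
  have lattice: "\<Lambda> = {pair_vec (m + n / q, c * n) | m n. m \<in> gaussian_ints \<and> n \<in> gaussian_ints}"
    unfolding assms(4) c_def by (rule gaussian_lattice_upper_triangular)
  have zero_int: "0 \<in> gaussian_ints" and one_int: "1 \<in> gaussian_ints"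
    using gaussian_ints_of_int[of 0] gaussian_ints_of_int[of 1] by simp_all
  have nat_int: "of_nat k \<in> gaussian_ints" for k
    using gaussian_ints_of_int[of "int k"] by simp
  define X where "X = {m + 1 / q | m. m \<in> gaussian_ints}"
  define Y where "Y = {c * q * m | m. m \<in> gaussian_ints}"
  define row where "row x = (\<lambda>y. pair_vec (x, y)) ` Y" for x
  define column where "column y = (\<lambda>x. pair_vec (x, y)) ` X" for y
  have inj_row: "inj_on (\<lambda>y. pair_vec (x, y)) Y" for x by (auto simp: inj_on_def pair_vec_eq_iff)
  have inj_column: "inj_on (\<lambda>x. pair_vec (x, y)) X" for y by (auto simp: inj_on_def pair_vec_eq_iff)
  have row_sub: "row 0 \<subseteq> \<Lambda>"
  proof
    fix v assume "v \<in> row 0"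
    then obtain n where n: "n \<in> gaussian_ints" "v = pair_vec (0, c * q * n)"
      by (auto simp: row_def Y_def)
    have "v = pair_vec (- n + (q * n) / q, c * (q * n))" using q0 n by (simp add: mult_ac)
    then show "v \<in> \<Lambda>"
      unfolding lattice using gaussian_ints_uminus[OF n(1)] gaussian_ints_mult[OF assms(1) n(1)] by blast
  qed
  have column_sub: "column c \<subseteq> \<Lambda>"
  proof
    fix v assume "v \<in> column c"
    then obtain m where m: "m \<in> gaussian_ints" "v = pair_vec (m + 1 / q, c * 1)"
      by (auto simp: column_def X_def)
    then show "v \<in> \<Lambda>" unfolding lattice using one_int by blast
  qed
  define I where "I = fock1_sqnorm (\<lambda>_. 1)"
  have I: "I \<ge> 0" by (simp add: I_def fock1_sqnorm_nonneg)
  define E where "E = gauss_density (\<lambda>_. 1) c"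
  have E: "E > 0" by (simp add: E_def gauss_density_def)
  \<comment> \<open>The test functions with a constant factor see a full row or column of the lattice
    with a fixed positive weight.\<close>
  have row_sum: "gauss_density g summable_on Y" "infsum (gauss_density g) Y \<le> B * I * fock1_sqnorm g"
    if g: "g \<in> fock1" for g
  proof -
    have eq: "w (\<lambda>_. 1) g (pair_vec (0, y)) = 1 * gauss_density g y" for y
      by (simp add: w_def gauss_density_def)
    note * = slice_sum_le[OF row_sub[unfolded row_def] inj_row samp(1)[OF one_in_fock1 g]
        samp(3)[OF one_in_fock1 g] w_nonneg eq zero_less_one]
    show "gauss_density g summable_on Y" by (rule *(1))
    show "infsum (gauss_density g) Y \<le> B * I * fock1_sqnorm g"
      using *(2) by (simp add: I_def mult_ac)
  qed
  have column_sum: "gauss_density f summable_on X" "infsum (gauss_density f) X \<le> B * I / E * fock1_sqnorm f"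
    if f: "f \<in> fock1" for f
  proof -
    have eq: "w f (\<lambda>_. 1) (pair_vec (x, c)) = E * gauss_density f x" for x
      by (simp add: w_def E_def)
    note * = slice_sum_le[OF column_sub[unfolded column_def] inj_column samp(1)[OF f one_in_fock1]
        samp(3)[OF f one_in_fock1] w_nonneg eq E]
    show "gauss_density f summable_on X" by (rule *(1))
    show "infsum (gauss_density f) X \<le> B * I / E * fock1_sqnorm f"
      using *(2) by (simp add: I_def mult_ac)
  qed
  have \<sigma>_per: "gauss_density fock_sigma (z + 1 * u) = gauss_density fock_sigma z" if "u \<in> gaussian_ints" for u z
    using fock_sigma_density_periodic[OF that] by simp
  obtain C where C: "C \<ge> 0" and f_ex: "\<And>K. \<exists>n. \<exists>f\<in>fock1. K \<le> fock1_sqnorm f \<and>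
       (\<forall>z. fock_sigma z = 0 \<longrightarrow> z \<noteq> 0 \<longrightarrow> z \<noteq> 0 + 1 * of_nat n \<longrightarrow> f z = 0) \<and>
       gauss_density f 0 \<le> C \<and> gauss_density f (0 + 1 * of_nat n) \<le> C"
    using divided_differences_escape[OF fock_sigma_holomorphic one_neq_zero \<sigma>_per fock_sigma_0 fock_sigma_nonzero]
    by blast
  obtain G p where G: "G holomorphic_on UNIV" "G p \<noteq> 0"
    "\<And>u z. u \<in> gaussian_ints \<Longrightarrow> gauss_density G (z + c * q * u) = gauss_density G z"
    "\<And>n. n \<in> gaussian_ints \<Longrightarrow> n / q \<notin> gaussian_ints \<Longrightarrow> G (c * n) = 0"
    unfolding c_def by (rule punctured_lattice_function[OF assms(1-3)]) blast
  have "1 / q \<notin> gaussian_ints"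
  proof
    assume "1 / q \<in> gaussian_ints"
    moreover have "cmod (1 / q) < 1" using assms(2) by (simp add: norm_divide divide_less_eq)
    ultimately have "1 / q = 0" by (rule gaussian_ints_norm_lt_1)
    then show False using q0 by simp
  qed
  then have Gc: "G c = 0" using G(4)[OF one_int] by simp
  have cq0: "c * q \<noteq> 0" using c0 q0 by simp
  obtain C' where C': "C' \<ge> 0" and g_ex: "\<And>K. \<exists>n. \<exists>g\<in>fock1. K \<le> fock1_sqnorm g \<and>
       (\<forall>z. G z = 0 \<longrightarrow> z \<noteq> c \<longrightarrow> z \<noteq> c + c * q * of_nat n \<longrightarrow> g z = 0) \<and>
       gauss_density g c \<le> C' \<and> gauss_density g (c + c * q * of_nat n) \<le> C'"
    using divided_differences_escape[OF G(1) cq0 G(3) Gc G(2)] by blast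
  define c1 where "c1 = 2 * C * (B * I)"
  define c2 where "c2 = 2 * C' * (B * I / E)"
  have c12: "c1 \<ge> 0" "c2 \<ge> 0" using C C' AB I E by (simp_all add: c1_def c2_def)
  \<comment> \<open>Squared norms of size at least \<open>K\<close> contradict the lower sampling inequality.\<close>
  define K where "K = (c1 + c2 + 1) / A"
  have K: "K > 0" "A * K > c1 + c2" using c12 AB by (simp_all add: K_def)
  obtain N f where f: "f \<in> fock1" "K \<le> fock1_sqnorm f"
    and f_zero: "\<And>z. fock_sigma z = 0 \<Longrightarrow> z \<noteq> 0 \<Longrightarrow> z \<noteq> of_nat N \<Longrightarrow> f z = 0"
    and fC: "gauss_density f 0 \<le> C" "gauss_density f (of_nat N) \<le> C"
    using f_ex[of K] by auto
  obtain M g where g: "g \<in> fock1" "K \<le> fock1_sqnorm g"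
    and g_zero: "\<And>z. G z = 0 \<Longrightarrow> z \<noteq> c \<Longrightarrow> z \<noteq> c + c * q * of_nat M \<Longrightarrow> g z = 0"
    and gC: "gauss_density g c \<le> C'" "gauss_density g (c + c * q * of_nat M) \<le> C'"
    using g_ex[of K] by blast
  \<comment> \<open>A row or column for each zero of \<open>\<sigma>\<close> or \<open>G\<close> that \<open>f\<close> or \<open>g\<close> has lost. The lost zeros \<open>\<gamma> n\<close> of
    \<open>G\<close> both have \<open>n\<close> congruent to \<open>1\<close> modulo \<open>q\<close>, so they share the set \<open>X\<close> of first coordinates.\<close>
  define S where "S = (row 0 \<union> row (of_nat N)) \<union> (column c \<union> column (c + c * q * of_nat M))"
  have support: "w f g v = 0" if v: "v \<in> \<Lambda>" "v \<notin> S" for v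
  proof -
    obtain m n where mn: "v = pair_vec (m + n / q, c * n)" "m \<in> gaussian_ints" "n \<in> gaussian_ints"
      using v(1) unfolding lattice by blast
    show ?thesis
    proof (cases "n / q \<in> gaussian_ints")
      case True
      have "c * n = c * q * (n / q)" using q0 by simp
      then have y: "c * n \<in> Y" using True unfolding Y_def by blast
      have "m + n / q \<noteq> 0" "m + n / q \<noteq> of_nat N"
        using v(2) y unfolding S_def mn(1) row_def by auto
      then have "f (m + n / q) = 0"
        using fock_sigma_gaussian_int[OF gaussian_ints_add[OF mn(2) True]] by (intro f_zero)
      then show ?thesis by (simp add: w_def mn gauss_density_def)
    next
      case False
      \<comment> \<open>Exclusion of the two zeros of \<open>G\<close> that \<open>g\<close> has lost, the first one as the case \<open>k = 0\<close>.\<close>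
      have off_column: "c * n \<noteq> y" if k: "y = c + c * q * of_nat k" and y: "column y \<subseteq> S" for y k
      proof
        assume "c * n = y"
        then have "c * n = c * (1 + q * of_nat k)" by (simp add: k algebra_simps)
        then have "n = 1 + q * of_nat k" using c0 by simp
        then have "m + n / q = (m + of_nat k) + 1 / q" using q0 by (simp add: add_divide_distrib)
        then have "m + n / q \<in> X" unfolding X_def using gaussian_ints_add[OF mn(2) nat_int] by blast
        then have "v \<in> column y" unfolding mn(1) column_def \<open>c * n = y\<close> by blast
        then show False using v(2) y by blast
      qed
      have "g (c * n) = 0"
      proof (rule g_zero)
        show "G (c * n) = 0" by (rule G(4)[OF mn(3) False])
        show "c * n \<noteq> c" by (rule off_column[of _ 0]) (auto simp: S_def)
        show "c * n \<noteq> c + c * q * of_nat M" by (rule off_column[of _ M]) (auto simp: S_def)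
      qed
      then show ?thesis by (simp add: w_def mn gauss_density_def)
    qed
  qed
  have row_bound: "w f g summable_on row x" "infsum (w f g) (row x) \<le> C * (B * I * fock1_sqnorm g)"
    if "gauss_density f x \<le> C" for x
  proof -
    have eq: "w f g (pair_vec (x, y)) = gauss_density f x * gauss_density g y" for y
      by (simp add: w_def)
    have "0 \<le> B * I * fock1_sqnorm g" using AB I fock1_sqnorm_nonneg by simp
    note * = infsum_scaled_slice_le[OF inj_row eq row_sum[OF g(1)] gauss_density_nonneg that this]
    show "w f g summable_on row x" "infsum (w f g) (row x) \<le> C * (B * I * fock1_sqnorm g)"
      unfolding row_def by (rule *(1), rule *(2))
  qed
  have column_bound: "w f g summable_on column y" "infsum (w f g) (column y) \<le> C' * (B * I / E * fock1_sqnorm f)"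
    if "gauss_density g y \<le> C'" for y
  proof -
    have eq: "w f g (pair_vec (x, y)) = gauss_density g y * gauss_density f x" for x
      by (simp add: w_def)
    have "0 \<le> B * I / E * fock1_sqnorm f" using AB I E fock1_sqnorm_nonneg by simp
    note * = infsum_scaled_slice_le[OF inj_column eq column_sum[OF f(1)] gauss_density_nonneg that this]
    show "w f g summable_on column y" "infsum (w f g) (column y) \<le> C' * (B * I / E * fock1_sqnorm f)"
      unfolding column_def by (rule *(1), rule *(2))
  qed
  note rows = infsum_Un_le[OF row_bound(1)[OF fC(1)] row_bound(1)[OF fC(2)] w_nonneg]
  note columns = infsum_Un_le[OF column_bound(1)[OF gC(1)] column_bound(1)[OF gC(2)] w_nonneg]
  note all = infsum_Un_le[OF rows(1) columns(1) w_nonneg]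
  have "infsum (w f g) \<Lambda> \<le> infsum (w f g) S"
  proof (rule infsum_mono_neutral[OF samp(1)[OF f(1) g(1)]])
    show "w f g summable_on S" unfolding S_def by (rule all(1))
    show "w f g v \<le> 0" if "v \<in> \<Lambda> - S" for v using support that by simp
  qed (auto intro: w_nonneg)
  also have "\<dots> \<le> (infsum (w f g) (row 0) + infsum (w f g) (row (of_nat N)))
      + (infsum (w f g) (column c) + infsum (w f g) (column (c + c * q * of_nat M)))"
    unfolding S_def by (rule order_trans[OF all(2) add_mono[OF rows(2) columns(2)]])
  also have "\<dots> \<le> (C * (B * I * fock1_sqnorm g) + C * (B * I * fock1_sqnorm g))
      + (C' * (B * I / E * fock1_sqnorm f) + C' * (B * I / E * fock1_sqnorm f))"
    by (intro add_mono row_bound(2) column_bound(2) fC gC)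
  also have "\<dots> = c1 * fock1_sqnorm g + c2 * fock1_sqnorm f"
    by (simp add: c1_def c2_def mult_ac)
  finally have upper: "A * (fock1_sqnorm f * fock1_sqnorm g) \<le> c1 * fock1_sqnorm g + c2 * fock1_sqnorm f"
    using samp(2)[OF f(1) g(1)] by linarith
  define P where "P = fock1_sqnorm f * fock1_sqnorm g"
  have P: "P > 0" using f(2) g(2) K(1) by (simp add: P_def)
  have Kg: "K * fock1_sqnorm g \<le> P"
    unfolding P_def by (rule mult_right_mono[OF f(2) fock1_sqnorm_nonneg])
  have Kf: "K * fock1_sqnorm f \<le> P"
    unfolding P_def mult.commute[of "fock1_sqnorm f"] by (rule mult_right_mono[OF g(2) fock1_sqnorm_nonneg])
  have "K * (A * P) \<le> K * (c1 * fock1_sqnorm g + c2 * fock1_sqnorm f)"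
    using upper K(1) unfolding P_def by (intro mult_left_mono) auto
  also have "\<dots> = c1 * (K * fock1_sqnorm g) + c2 * (K * fock1_sqnorm f)" by (simp add: algebra_simps)
  also have "\<dots> \<le> c1 * P + c2 * P" using Kg Kf c12 by (intro add_mono mult_left_mono)
  finally have "(A * K) * P \<le> (c1 + c2) * P" by (simp add: algebra_simps)
  then have "A * K \<le> c1 + c2" using P by (rule mult_right_le_imp_le)
  then show False using K(2) by simp
qed

end
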